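(* Let $\Omega=(0,1)^2$ and let $\{(\phi_{m,n},\lambda_{m,n})\}_{m,n\ge1}$ denote the $L^2(\Omega)$-orthonormal Dirichlet eigenpairs of $-\Delta$, with $\lambda_{m,n}=\pi^2(m^2+n^2)$. Assume $u\in H^2(\Omega)\cap H_0^1(\Omega)$ and write $u=\sum_{m,n\ge1}\hat u_{m,n}\phi_{m,n}$. For $M\ge1$, define the rectangular spectral projector $$\Pi_M u:=\sum_{1\le m\le M}\sum_{1\le n\le M}\hat u_{m,n}\phi_{m,n}.$$ Then there exists a constant $C>0$, independent of $M$, such that $$\|u-\Pi_M u\|_{H_0^1(\Omega)}\le C\,\frac{\sqrt{\log M}}{M}\,\|u\|_{H^2(\Omega)}.$$
   Context: The norm on $H_0^1(\Omega)$ is $\|u\|_{H_0^1}=\left(\int_\Omega|\nabla u|^2\,dx\right)^{1/2}$. The eigenfunction $\phi_{m,n}$ is the $L^2(\Omega)$-normalized multiple of $\sin(m\pi x)\sin(n\pi y)$, and $\hat u_{m,n}$ are the coefficients of $u$ in this orthonormal basis. The cutoff $M$ is an integer.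
   Formalization: The estimate is stated for M ≥ 2 instead of M ≥ 1, since at M = 1 the right-hand side vanishes (log 1 = 0) while the left-hand side is positive, e.g. for u = φ_{2,1}. *)

theory Defs
  imports "HOL-Analysis.Analysis"
begin

section \<open>Classical partial derivatives and test functions on the plane\<close>

type_synonym plane = "real \<times> real"

definition partial :: "plane \<Rightarrow> (plane \<Rightarrow> real) \<Rightarrow> plane \<Rightarrow> real" where
  "partial v f = (\<lambda>p. frechet_derivative f (at p) v)"

text \<open>The multi-index (a, b) stands for a derivatives in the first and b in the second variable.\<close>

definition classical_deriv :: "nat \<times> nat \<Rightarrow> (plane \<Rightarrow> real) \<Rightarrow> plane \<Rightarrow> real" where
  "classical_deriv \<alpha> f = (partial (1, 0) ^^ fst \<alpha>) ((partial (0, 1) ^^ snd \<alpha>) f)"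

primrec C_k :: "nat \<Rightarrow> (plane \<Rightarrow> real) \<Rightarrow> bool" where
  "C_k 0 f \<longleftrightarrow> continuous_on UNIV f"
| "C_k (Suc k) f \<longleftrightarrow> f differentiable_on UNIV \<and> (\<forall>v\<in>Basis. C_k k (partial v f))"

text \<open>The space of smooth functions on the plane whose support is a compact subset of S, that is,
  the elements of C-infinity-c(S) extended by zero.\<close>

definition test_functions :: "plane set \<Rightarrow> (plane \<Rightarrow> real) set" where
  "test_functions S =
     {\<psi>. (\<forall>k. C_k k \<psi>) \<and> compact (closure {p. \<psi> p \<noteq> 0}) \<and> closure {p. \<psi> p \<noteq> 0} \<subseteq> S}"

section \<open>Square-integrable functions\<close>

text \<open>Elements of the function spaces below are representatives: functions on the whole plane of
  which only the almost-everywhere class on S matters.\<close>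

definition L2 :: "plane set \<Rightarrow> (plane \<Rightarrow> real) set" where
  "L2 S = {f. f \<in> borel_measurable (lebesgue_on S) \<and> integrable (lebesgue_on S) (\<lambda>p. (f p)\<^sup>2)}"

definition L2_inner :: "plane set \<Rightarrow> (plane \<Rightarrow> real) \<Rightarrow> (plane \<Rightarrow> real) \<Rightarrow> real" where
  "L2_inner S f g = (LINT p|lebesgue_on S. f p * g p)"

definition L2_norm :: "plane set \<Rightarrow> (plane \<Rightarrow> real) \<Rightarrow> real" where
  "L2_norm S f = sqrt (LINT p|lebesgue_on S. (f p)\<^sup>2)"

section \<open>Weak derivatives and Sobolev spaces\<close>

definition has_weak_deriv ::
  "plane set \<Rightarrow> nat \<times> nat \<Rightarrow> (plane \<Rightarrow> real) \<Rightarrow> (plane \<Rightarrow> real) \<Rightarrow> bool" where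
  "has_weak_deriv S \<alpha> u v \<longleftrightarrow> u \<in> L2 S \<and> v \<in> L2 S \<and>
     (\<forall>\<psi>\<in>test_functions S.
        (LINT p|lebesgue_on S. u p * classical_deriv \<alpha> \<psi> p) =
        (- 1) ^ (fst \<alpha> + snd \<alpha>) * (LINT p|lebesgue_on S. v p * \<psi> p))"

text \<open>For open S a weak derivative is unique up to a null set, so the choice of a representative
  does not affect the norms below.\<close>

definition weak_deriv :: "plane set \<Rightarrow> nat \<times> nat \<Rightarrow> (plane \<Rightarrow> real) \<Rightarrow> plane \<Rightarrow> real" where
  "weak_deriv S \<alpha> u = (SOME v. has_weak_deriv S \<alpha> u v)"

definition weak_grad :: "plane set \<Rightarrow> (plane \<Rightarrow> real) \<Rightarrow> plane \<Rightarrow> plane" where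
  "weak_grad S u p = (weak_deriv S (1, 0) u p, weak_deriv S (0, 1) u p)"

definition sobolev :: "nat \<Rightarrow> plane set \<Rightarrow> (plane \<Rightarrow> real) set" where
  "sobolev k S = {u. \<forall>\<alpha>. fst \<alpha> + snd \<alpha> \<le> k \<longrightarrow> (\<exists>v. has_weak_deriv S \<alpha> u v)}"

definition sobolev_norm :: "nat \<Rightarrow> plane set \<Rightarrow> (plane \<Rightarrow> real) \<Rightarrow> real" where
  "sobolev_norm k S u =
     sqrt (\<Sum>\<alpha> | fst \<alpha> + snd \<alpha> \<le> k. (L2_norm S (weak_deriv S \<alpha> u))\<^sup>2)"

text \<open>The closure of the test functions in the full first-order Sobolev norm.\<close>

definition H10 :: "plane set \<Rightarrow> (plane \<Rightarrow> real) set" where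
  "H10 S = {u \<in> sobolev 1 S. \<exists>\<psi> :: nat \<Rightarrow> plane \<Rightarrow> real. (\<forall>k. \<psi> k \<in> test_functions S) \<and>
     (\<lambda>k. sobolev_norm 1 S (\<lambda>p. u p - \<psi> k p)) \<longlonglongrightarrow> 0}"

text \<open>Here norm is the Euclidean norm of the gradient vector.\<close>

definition H10_norm :: "plane set \<Rightarrow> (plane \<Rightarrow> real) \<Rightarrow> real" where
  "H10_norm S u = sqrt (LINT p|lebesgue_on S. (norm (weak_grad S u p))\<^sup>2)"

section \<open>Dirichlet eigenpairs of the unit square and the spectral projector\<close>

definition unit_square :: "plane set" where
  "unit_square = {0<..<1} \<times> {0<..<1}"

definition sin_mode :: "nat \<Rightarrow> nat \<Rightarrow> plane \<Rightarrow> real" where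
  "sin_mode m n p = sin (real m * pi * fst p) * sin (real n * pi * snd p)"

definition eigenfun :: "nat \<Rightarrow> nat \<Rightarrow> plane \<Rightarrow> real" where
  "eigenfun m n p = sin_mode m n p / L2_norm unit_square (sin_mode m n)"

definition eigenval :: "nat \<Rightarrow> nat \<Rightarrow> real" where
  "eigenval m n = pi\<^sup>2 * ((real m)\<^sup>2 + (real n)\<^sup>2)"

definition eigen_coeff :: "(plane \<Rightarrow> real) \<Rightarrow> nat \<Rightarrow> nat \<Rightarrow> real" where
  "eigen_coeff u m n = L2_inner unit_square u (eigenfun m n)"

definition spectral_proj :: "nat \<Rightarrow> (plane \<Rightarrow> real) \<Rightarrow> plane \<Rightarrow> real" where
  "spectral_proj M u p = (\<Sum>m=1..M. \<Sum>n=1..M. eigen_coeff u m n * eigenfun m n p)"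

text \<open>The functions eigenfun m n with m, n at least 1 are L2-orthonormal Dirichlet eigenfunctions
  of the negative Laplacian with eigenvalues eigenval m n.\<close>

lemma integral_sin_sin:
  assumes "m \<ge> 1" "k \<ge> 1"
  shows "integral {0..1} (\<lambda>x. sin (real m * pi * x) * sin (real k * pi * x)) =
    (if m = k then 1/2 else 0)"
proof (cases "m = k")
  case True
  define F where "F = (\<lambda>x. x / 2 - sin (2 * (real m * pi * x)) / (4 * (real m * pi)))"
  have "((\<lambda>x. sin (real m * pi * x) * sin (real m * pi * x)) has_integral (F 1 - F 0)) {0..1}"
  proof (rule fundamental_theorem_of_calculus)
    fix x :: real
    have "(F has_real_derivative sin (real m * pi * x) * sin (real m * pi * x)) (at x)"
      unfolding F_def using assms
      by (auto intro!: derivative_eq_intros simp: cos_double_sin power2_eq_square diff_divide_distrib)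
    then show "(F has_vector_derivative sin (real m * pi * x) * sin (real m * pi * x))
        (at x within {0..1})"
      by (simp add: has_real_derivative_iff_has_vector_derivative has_vector_derivative_at_within)
  qed simp
  moreover have "F 1 - F 0 = 1/2"
    using sin_npi2[of "2 * m"] by (simp add: F_def mult_ac)
  ultimately show ?thesis
    using True by (simp add: integral_unique)
next
  case False
  define a where "a = (real m - real k) * pi"
  define b where "b = (real m + real k) * pi"
  have nz: "a \<noteq> 0" "b \<noteq> 0" using False assms by (auto simp: a_def b_def)
  define F where "F = (\<lambda>x. sin (a * x) / (2 * a) - sin (b * x) / (2 * b))"
  have eq: "sin (real m * pi * x) * sin (real k * pi * x) = (cos (a * x) - cos (b * x)) / 2" for x
  proof -
    have "a * x = real m * pi * x - real k * pi * x" "b * x = real m * pi * x + real k * pi * x"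
      by (simp_all add: a_def b_def algebra_simps)
    then show ?thesis
      by (simp only: sin_times_sin)
  qed
  have "((\<lambda>x. (cos (a * x) - cos (b * x)) / 2) has_integral (F 1 - F 0)) {0..1}"
  proof (rule fundamental_theorem_of_calculus)
    fix x :: real
    have "(F has_real_derivative (cos (a * x) - cos (b * x)) / 2) (at x)"
      unfolding F_def using nz
      by (auto intro!: derivative_eq_intros simp: field_simps)
    then show "(F has_vector_derivative (cos (a * x) - cos (b * x)) / 2) (at x within {0..1})"
      by (simp add: has_real_derivative_iff_has_vector_derivative has_vector_derivative_at_within)
  qed simp
  then have "integral {0..1} (\<lambda>x. sin (real m * pi * x) * sin (real k * pi * x)) = F 1 - F 0"
    unfolding eq by (rule integral_unique)
  moreover have "sin a = 0" "sin b = 0"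
    by (auto simp: a_def b_def sin_diff sin_add algebra_simps)
  ultimately show ?thesis
    using False by (simp add: F_def)
qed

lemma integral_sin_mode:
  assumes "m \<ge> 1" "n \<ge> 1" "k \<ge> 1" "l \<ge> 1"
  shows "(LINT p|lebesgue_on unit_square. sin_mode m n p * sin_mode k l p) =
    (if (m, n) = (k, l) then 1/4 else 0)"
proof -
  let ?f = "\<lambda>p. sin_mode m n p * sin_mode k l p"
  have box: "unit_square = box (0, 0) (1, 1)"
    by (auto simp: unit_square_def mem_box Basis_prod_def)
  have cont: "continuous_on A ?f" for A
    unfolding sin_mode_def by (intro continuous_intros)
  have "set_integrable lebesgue (cbox (0, 0) (1, 1)) ?f"
    using absolutely_integrable_continuous[OF cont] by simp
  then have "set_integrable lebesgue unit_square ?f"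
    by (rule set_integrable_subset) (simp_all add: box box_subset_cbox)
  then have "integrable (lebesgue_on unit_square) ?f"
    by (simp add: integrable_restrict_space set_integrable_def box)
  then have "(LINT p|lebesgue_on unit_square. ?f p) = integral unit_square ?f"
    by (intro lebesgue_integral_eq_integral) (simp_all add: box)
  also have "\<dots> = integral (cbox (0, 0) (1, 1)) ?f"
    by (simp add: box integral_open_interval)
  also have "\<dots> = integral (cbox 0 1) (\<lambda>x. integral (cbox 0 1) (\<lambda>y. ?f (x, y)))"
    using cont by (rule integral_prod_continuous)
  also have "\<dots> = integral {0..1} (\<lambda>x. integral {0..1} (\<lambda>y.
      (sin (real m * pi * x) * sin (real k * pi * x)) *
      (sin (real n * pi * y) * sin (real l * pi * y))))"
    by (simp add: sin_mode_def mult_ac)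
  also have "\<dots> = (if (m, n) = (k, l) then 1/4 else 0)"
    using assms by (auto simp: integral_sin_sin)
  finally show ?thesis .
qed

lemma eigenfun_eq:
  assumes "m \<ge> 1" "n \<ge> 1"
  shows "eigenfun m n p = 2 * sin (real m * pi * fst p) * sin (real n * pi * snd p)"
proof -
  have "L2_norm unit_square (sin_mode m n) = 1/2"
    using integral_sin_mode[OF assms assms]
    by (simp only: L2_norm_def power2_eq_square) (simp add: real_sqrt_divide)
  then have "eigenfun m n p = sin_mode m n p / (1/2)"
    by (simp only: eigenfun_def)
  then show ?thesis
    by (simp add: sin_mode_def)
qed

lemma eigenfun_orthonormal:
  assumes "m \<ge> 1" "n \<ge> 1" "k \<ge> 1" "l \<ge> 1"
  shows "L2_inner unit_square (eigenfun m n) (eigenfun k l) = (if (m, n) = (k, l) then 1 else 0)"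
proof -
  have "eigenfun m n p * eigenfun k l p = 4 * (sin_mode m n p * sin_mode k l p)" for p
    using assms by (simp add: eigenfun_eq sin_mode_def)
  then show ?thesis
    using integral_sin_mode[OF assms] by (simp add: L2_inner_def)
qed

lemma eigenfun_boundary:
  assumes "p \<in> frontier unit_square"
  shows "eigenfun m n p = 0"
proof -
  have "p \<in> ({0..1} \<times> {0..1}) - ({0<..<1} \<times> {0<..<1})"
    using assms by (simp add: unit_square_def frontier_def closure_Times interior_Times)
  then have "fst p = 0 \<or> fst p = 1 \<or> snd p = 0 \<or> snd p = 1"
    by (cases p) auto
  then show ?thesis
    by (auto simp: eigenfun_def sin_mode_def)
qed

lemma partial_eq:
  assumes "\<And>p. (f has_derivative D p) (at p)"
  shows "partial v f = (\<lambda>p. D p v)"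
  unfolding partial_def using frechet_derivative_at[OF assms] by simp

lemma eigenfun_laplacian:
  "- (classical_deriv (2, 0) (eigenfun m n) p + classical_deriv (0, 2) (eigenfun m n) p) =
     eigenval m n * eigenfun m n p"
proof -
  define c where "c = 1 / L2_norm unit_square (sin_mode m n)"
  define a where "a = real m * pi"
  define b where "b = real n * pi"
  have e: "eigenfun m n = (\<lambda>p. c * (sin (a * fst p) * sin (b * snd p)))"
    by (auto simp: eigenfun_def sin_mode_def c_def a_def b_def)
  have 1: "partial (1, 0) (\<lambda>p. c * (sin (a * fst p) * sin (b * snd p))) =
      (\<lambda>p. c * (a * cos (a * fst p) * sin (b * snd p)))"
    by (subst partial_eq, (rule derivative_eq_intros refl)+) auto
  have 2: "partial (1, 0) (\<lambda>p. c * (a * cos (a * fst p) * sin (b * snd p))) =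
      (\<lambda>p. - c * a\<^sup>2 * (sin (a * fst p) * sin (b * snd p)))"
    by (subst partial_eq, (rule derivative_eq_intros refl)+) (auto simp: power2_eq_square)
  have 3: "partial (0, 1) (\<lambda>p. c * (sin (a * fst p) * sin (b * snd p))) =
      (\<lambda>p. c * (b * sin (a * fst p) * cos (b * snd p)))"
    by (subst partial_eq, (rule derivative_eq_intros refl)+) auto
  have 4: "partial (0, 1) (\<lambda>p. c * (b * sin (a * fst p) * cos (b * snd p))) =
      (\<lambda>p. - c * b\<^sup>2 * (sin (a * fst p) * sin (b * snd p)))"
    by (subst partial_eq, (rule derivative_eq_intros refl)+) (auto simp: power2_eq_square)
  show ?thesis
    by (simp only: classical_deriv_def e numeral_2_eq_2 fst_conv snd_conv funpow.simps o_apply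
        id_apply 1 2 3 4 eigenval_def)
       (simp add: a_def b_def power2_eq_square algebra_simps)
qed

end

theory Submission
  imports Defs
begin

text \<open>Both u and the sine modes satisfy Green's formula without a boundary term, so f = -\<Delta>u has the
  coefficients \<lambda>(m,n) times those of u. For the error w = u - P u of the projector P with cutoff M the
  same formula gives that the integral of |grad w|^2 equals that of (f - P f) w. Since the sine system is
  complete, this is the sum of f(m,n)^2 / \<lambda>(m,n) over the pairs outside the square of side M, where
  \<lambda>(m,n) is at least (\<pi>M)^2, and Bessel's inequality for f concludes. The resulting rate 1/M is better
  than the claimed one; the logarithm only enters through ln M \<ge> ln 2.\<close>

section \<open>Square-integrable functions\<close>

text \<open>The energy identity tests Green's formula with the error \<open>w\<close> itself, so
  \<open>w\<close> must be reached by compactly supported functions. The sine modes inside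
  \<open>w\<close> lack compact support; they are cut off near the edges, and the limit exists
  because a mode vanishes linearly at an edge, which compensates the 1/distance growth of the
  derivative of the cutoff. Completeness is needed only as weak convergence in L2: the energy of
  \<open>w\<close> is one pairing with a fixed function, so convergence of the projections in the
  energy norm is never proved. Hence uniform approximation of test functions by sine sums is enough.
  The norms refer to weak derivatives picked by Hilbert choice; almost-everywhere uniqueness, proved
  with the same cutoffs, lets any concrete derivative stand in for the picked one. The factor 2 in
  the energy bound comes from \<open>(a + b)^2 \<le> 2 * (a^2 + b^2)\<close> for the two pure second
  derivatives. The resulting rate is \<open>sqrt 2 / (pi * M)\<close>, and
  \<open>2 / pi^2 \<le> ln 2\<close> makes the constant 1 sufficient.\<close>

lemma L2_integrable_mult:
  assumes "f \<in> L2 S" "g \<in> L2 S"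
  shows "integrable (lebesgue_on S) (\<lambda>p. f p * g p)"
proof (rule Bochner_Integration.integrable_bound)
  show "integrable (lebesgue_on S) (\<lambda>p. (f p)\<^sup>2 + (g p)\<^sup>2)"
    using assms by (simp add: L2_def)
  show "(\<lambda>p. f p * g p) \<in> borel_measurable (lebesgue_on S)"
    using assms by (auto simp: L2_def)
  have "\<bar>a * b\<bar> \<le> a\<^sup>2 + b\<^sup>2" for a b :: real
  proof -
    have "0 \<le> (a - b)\<^sup>2" "0 \<le> (a + b)\<^sup>2" "0 \<le> a\<^sup>2" "0 \<le> b\<^sup>2"
      by simp_all
    then show ?thesis by (simp add: power2_diff power2_sum abs_le_iff)
  qed
  then show "AE p in lebesgue_on S. norm (f p * g p) \<le> norm ((f p)\<^sup>2 + (g p)\<^sup>2)"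
    by simp
qed

lemma L2_add: "f \<in> L2 S \<Longrightarrow> g \<in> L2 S \<Longrightarrow> (\<lambda>p. f p + g p) \<in> L2 S"
  using L2_integrable_mult[of f S g] by (auto simp: L2_def power2_sum mult.assoc)

lemma L2_cmult: "f \<in> L2 S \<Longrightarrow> (\<lambda>p. c * f p) \<in> L2 S"
  by (auto simp: L2_def power_mult_distrib)

lemma L2_minus: "f \<in> L2 S \<Longrightarrow> (\<lambda>p. - f p) \<in> L2 S"
  using L2_cmult[of f S "-1"] by simp

lemma L2_diff: "f \<in> L2 S \<Longrightarrow> g \<in> L2 S \<Longrightarrow> (\<lambda>p. f p - g p) \<in> L2 S"
  using L2_add[OF _ L2_minus, of f S g] by simp

lemma L2_zero: "(\<lambda>p. 0) \<in> L2 S"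
  by (simp add: L2_def)

lemma L2_sum: "(\<And>i. i \<in> I \<Longrightarrow> f i \<in> L2 S) \<Longrightarrow> (\<lambda>p. \<Sum>i\<in>I. f i p) \<in> L2 S"
  by (induction I rule: infinite_finite_induct) (auto simp: L2_zero intro: L2_add)

lemmas L2_intros = L2_add L2_cmult L2_minus L2_diff L2_zero L2_sum

lemma L2_inner_commute: "L2_inner S f g = L2_inner S g f"
  by (simp add: L2_inner_def mult.commute)

lemma L2_inner_cmult_left: "L2_inner S (\<lambda>p. c * f p) g = c * L2_inner S f g"
  by (simp add: L2_inner_def mult.assoc)

lemma L2_inner_cmult_right: "L2_inner S g (\<lambda>p. c * f p) = c * L2_inner S g f"
  using L2_inner_cmult_left L2_inner_commute by metis

lemma L2_inner_minus_left: "L2_inner S (\<lambda>p. - f p) g = - L2_inner S f g"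
  using L2_inner_cmult_left[of S "-1"] by simp

lemma L2_inner_minus_right: "L2_inner S g (\<lambda>p. - f p) = - L2_inner S g f"
  using L2_inner_cmult_right[of S g "-1"] by simp

lemma L2_inner_add_left:
  "f \<in> L2 S \<Longrightarrow> g \<in> L2 S \<Longrightarrow> h \<in> L2 S \<Longrightarrow>
    L2_inner S (\<lambda>p. f p + g p) h = L2_inner S f h + L2_inner S g h"
  by (simp add: L2_inner_def distrib_right L2_integrable_mult)

lemma L2_inner_add_right:
  "f \<in> L2 S \<Longrightarrow> g \<in> L2 S \<Longrightarrow> h \<in> L2 S \<Longrightarrow>
    L2_inner S h (\<lambda>p. f p + g p) = L2_inner S h f + L2_inner S h g"
  by (simp add: L2_inner_def distrib_left L2_integrable_mult)

lemma L2_inner_diff_left: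
  "f \<in> L2 S \<Longrightarrow> g \<in> L2 S \<Longrightarrow> h \<in> L2 S \<Longrightarrow>
    L2_inner S (\<lambda>p. f p - g p) h = L2_inner S f h - L2_inner S g h"
  by (simp add: L2_inner_def left_diff_distrib L2_integrable_mult)

lemma L2_inner_diff_right:
  "f \<in> L2 S \<Longrightarrow> g \<in> L2 S \<Longrightarrow> h \<in> L2 S \<Longrightarrow>
    L2_inner S h (\<lambda>p. f p - g p) = L2_inner S h f - L2_inner S h g"
  by (simp add: L2_inner_def right_diff_distrib L2_integrable_mult)

lemma L2_inner_zero: "L2_inner S (\<lambda>p. 0) h = 0" "L2_inner S h (\<lambda>p. 0) = 0"
  by (simp_all add: L2_inner_def)

lemma L2_inner_sum_left:
  assumes "\<And>i. i \<in> I \<Longrightarrow> f i \<in> L2 S" "h \<in> L2 S"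
  shows "L2_inner S (\<lambda>p. \<Sum>i\<in>I. f i p) h = (\<Sum>i\<in>I. L2_inner S (f i) h)"
  using assms(1)
  by (induction I rule: infinite_finite_induct)
    (simp_all add: L2_inner_zero L2_inner_add_left L2_sum assms(2))

lemma L2_inner_sum_right:
  assumes "\<And>i. i \<in> I \<Longrightarrow> f i \<in> L2 S" "h \<in> L2 S"
  shows "L2_inner S h (\<lambda>p. \<Sum>i\<in>I. f i p) = (\<Sum>i\<in>I. L2_inner S h (f i))"
  using L2_inner_sum_left[OF assms] by (simp add: L2_inner_commute)

lemmas L2_inner_simps = L2_inner_cmult_left L2_inner_cmult_right L2_inner_minus_left
  L2_inner_minus_right L2_inner_add_left L2_inner_add_right L2_inner_diff_left
  L2_inner_diff_right L2_inner_sum_left L2_inner_sum_right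

lemma L2_inner_AE_cong:
  assumes "f \<in> L2 S" "f' \<in> L2 S" "g \<in> L2 S" "g' \<in> L2 S"
    and "AE p in lebesgue_on S. f p = f' p" "AE p in lebesgue_on S. g p = g' p"
  shows "L2_inner S f g = L2_inner S f' g'"
  unfolding L2_inner_def
  by (rule integral_cong_AE) (use assms in \<open>auto simp: L2_integrable_mult borel_measurable_integrable\<close>)

lemma L2_norm_nonneg: "0 \<le> L2_norm S f"
  by (simp add: L2_norm_def)

lemma L2_norm_power2: "(L2_norm S f)\<^sup>2 = L2_inner S f f"
  by (simp add: L2_norm_def L2_inner_def power2_eq_square)

lemma L2_inner_self_nonneg: "0 \<le> L2_inner S f f"
  by (simp add: L2_inner_def)

text \<open>\<open>L2_inner\<close> acts on representatives and is only positive semidefinite, so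
  the discriminant argument is carried out directly, with a separate case for a second function of
  norm 0.\<close>

lemma L2_Cauchy_Schwarz:
  assumes "f \<in> L2 S" "g \<in> L2 S"
  shows "\<bar>L2_inner S f g\<bar> \<le> L2_norm S f * L2_norm S g"
proof -
  define a b c where "a = L2_inner S f f" "b = L2_inner S f g" "c = L2_inner S g g"
  have quad: "0 \<le> a + 2 * t * b + t\<^sup>2 * c" for t
  proof -
    have "0 \<le> L2_inner S (\<lambda>p. f p + t * g p) (\<lambda>p. f p + t * g p)"
      by (rule L2_inner_self_nonneg)
    also have "\<dots> = a + 2 * t * b + t\<^sup>2 * c"
      using L2_inner_commute[of S g f] assms
      by (simp add: a_b_c_def L2_inner_simps L2_intros power2_eq_square algebra_simps)
    finally show ?thesis .
  qed
  have "b\<^sup>2 \<le> a * c"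
  proof (cases "c = 0")
    case True
    have "b = 0"
    proof (rule ccontr)
      assume "b \<noteq> 0"
      \<comment> \<open>With \<open>c = 0\<close> the quadratic is affine in \<open>t\<close>, and
        this \<open>t\<close> would give it the value -1.\<close>
      then have "2 * (- (a + 1) / (2 * b)) * b = - (a + 1)" by simp
      then show False using quad[of "- (a + 1) / (2 * b)"] True by simp
    qed
    then show ?thesis using True by simp
  next
    case False
    then have "c > 0" by (smt (verit) L2_inner_self_nonneg a_b_c_def)
    \<comment> \<open>\<open>t = - b / c\<close> minimizes the quadratic; the factor
      \<open>c\<close> clears the denominator.\<close>
    have "0 \<le> (a + 2 * (- b / c) * b + (- b / c)\<^sup>2 * c) * c"
      using quad[of "- b / c"] \<open>c > 0\<close> by (intro mult_nonneg_nonneg) auto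
    also have "\<dots> = a * c - b\<^sup>2"
      using \<open>c > 0\<close> by (simp add: field_simps power2_eq_square)
    finally show ?thesis by simp
  qed
  then have "b\<^sup>2 \<le> (L2_norm S f * L2_norm S g)\<^sup>2"
    by (simp add: power_mult_distrib L2_norm_power2 a_b_c_def)
  then show ?thesis
    using abs_le_square_iff[of b "L2_norm S f * L2_norm S g"] L2_norm_nonneg[of S f] L2_norm_nonneg[of S g]
    by (simp add: a_b_c_def)
qed

text \<open>Norm convergence implies weak convergence, by Cauchy-Schwarz against the fixed
  \<open>g\<close>.\<close>

lemma L2_inner_tendsto:
  assumes "\<And>k. F k \<in> L2 S" "f \<in> L2 S" "g \<in> L2 S"
    and lim: "(\<lambda>k. L2_norm S (\<lambda>p. f p - F k p)) \<longlonglongrightarrow> 0"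
  shows "(\<lambda>k. L2_inner S g (F k)) \<longlonglongrightarrow> L2_inner S g f"
proof -
  have "(\<lambda>k. L2_norm S g * L2_norm S (\<lambda>p. f p - F k p)) \<longlonglongrightarrow> 0"
    using tendsto_mult_right_zero[OF lim] .
  then have "(\<lambda>k. L2_inner S g f - L2_inner S g (F k)) \<longlonglongrightarrow> 0"
  proof (rule tendsto_0_le[where K = 1], intro always_eventually allI)
    fix k
    have "\<bar>L2_inner S g (\<lambda>p. f p - F k p)\<bar> \<le> L2_norm S g * L2_norm S (\<lambda>p. f p - F k p)"
      using assms by (intro L2_Cauchy_Schwarz L2_intros)
    then show "norm (L2_inner S g f - L2_inner S g (F k))
        \<le> norm (L2_norm S g * L2_norm S (\<lambda>p. f p - F k p)) * 1"
      using assms by (simp add: L2_inner_diff_right)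
  qed
  from tendsto_diff[OF tendsto_const[of "L2_inner S g f"] this] show ?thesis by simp
qed

section \<open>The unit square\<close>

abbreviation "lsq \<equiv> lebesgue_on unit_square"

lemma unit_square_eq_box: "unit_square = box (0, 0) (1, 1)"
  by (auto simp: unit_square_def mem_box Basis_prod_def)

lemma open_unit_square: "open unit_square"
  by (simp only: unit_square_eq_box open_box)

lemma mem_unit_square: "p \<in> unit_square \<longleftrightarrow> 0 < fst p \<and> fst p < 1 \<and> 0 < snd p \<and> snd p < 1"
  by (cases p) (auto simp: unit_square_def)

lemma finite_measure_lsq: "finite_measure lsq"
  by (rule finite_measure_lebesgue_on) (simp add: unit_square_eq_box)

lemma space_lsq: "space lsq = unit_square"
  by (simp add: space_restrict_space)

lemma continuous_cbox_L2:
  assumes "continuous_on (cbox (0, 0) (1, 1)) f"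
  shows "f \<in> L2 unit_square"
proof -
  have ac: "g absolutely_integrable_on unit_square" if "continuous_on (cbox (0, 0) (1, 1)) g"
    for g :: "plane \<Rightarrow> real"
    using absolutely_integrable_continuous[OF that]
    by (rule set_integrable_subset) (simp_all add: unit_square_eq_box box_subset_cbox)
  then have int: "integrable lsq g" if "continuous_on (cbox (0, 0) (1, 1)) g" for g :: "plane \<Rightarrow> real"
    using that by (simp add: integrable_restrict_space set_integrable_def unit_square_eq_box)
  show ?thesis
    using int[OF assms] int[OF continuous_on_power[OF assms, of 2]]
    by (simp add: L2_def borel_measurable_integrable)
qed

lemma continuous_L2: "continuous_on UNIV f \<Longrightarrow> f \<in> L2 unit_square"
  by (rule continuous_cbox_L2) (rule continuous_on_subset, auto)

lemma L2_integrable: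
  assumes "f \<in> L2 unit_square"
  shows "integrable lsq f"
  using L2_integrable_mult[OF assms continuous_L2[OF continuous_on_const[of _ 1]]] by simp

text \<open>Weak convergence from bounded pointwise convergence: \<open>\<bar>g p\<bar> * B\<close>
  dominates, and it is integrable because the square has finite measure. This is how limits of
  cutoffs are taken.\<close>

lemma L2_inner_dominated:
  assumes g: "g \<in> L2 unit_square" and F: "\<And>k. F k \<in> L2 unit_square" and f: "f \<in> L2 unit_square"
    and lim: "\<And>p. p \<in> unit_square \<Longrightarrow> (\<lambda>k. F k p) \<longlonglongrightarrow> f p"
    and bound: "\<And>k p. p \<in> unit_square \<Longrightarrow> \<bar>F k p\<bar> \<le> B"
  shows "(\<lambda>k. L2_inner unit_square g (F k)) \<longlonglongrightarrow> L2_inner unit_square g f"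
  unfolding L2_inner_def
proof (rule integral_dominated_convergence)
  show "(\<lambda>p. g p * f p) \<in> borel_measurable lsq" "(\<lambda>p. g p * F k p) \<in> borel_measurable lsq" for k
    using L2_integrable_mult[OF g f] L2_integrable_mult[OF g F] by (auto simp: borel_measurable_integrable)
  show "integrable lsq (\<lambda>p. \<bar>g p\<bar> * B)"
    using L2_integrable[OF g] by simp
  show "AE p in lsq. (\<lambda>k. g p * F k p) \<longlonglongrightarrow> g p * f p"
    by (rule AE_I2) (auto simp: space_lsq intro!: tendsto_mult lim)
  show "AE p in lsq. norm (g p * F k p) \<le> \<bar>g p\<bar> * B" for k
    by (rule AE_I2) (auto simp: space_lsq abs_mult intro!: mult_left_mono bound)
qed

section \<open>Smooth functions of one variable and tensor products\<close>

text \<open>One-variable counterpart of \<open>C_k\<close>. The derivative is an existential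
  witness, so each closure rule is an induction that supplies the derivative formula.\<close>

primrec smooth_upto :: "nat \<Rightarrow> (real \<Rightarrow> real) \<Rightarrow> bool" where
  "smooth_upto 0 f \<longleftrightarrow> continuous_on UNIV f"
| "smooth_upto (Suc k) f \<longleftrightarrow> (\<exists>f'. (\<forall>x. (f has_real_derivative f' x) (at x)) \<and> smooth_upto k f')"

lemma smooth_upto_SucI:
  "(\<And>x. (f has_real_derivative f' x) (at x)) \<Longrightarrow> smooth_upto k f' \<Longrightarrow> smooth_upto (Suc k) f"
  by auto

lemma has_real_derivative_continuous_on:
  "(\<And>x. (f has_real_derivative f' x) (at x)) \<Longrightarrow> continuous_on A f"
  by (meson DERIV_isCont continuous_at_imp_continuous_on)

lemma smooth_upto_Suc_D: "smooth_upto (Suc k) f \<Longrightarrow> smooth_upto k f"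
proof (induction k arbitrary: f)
  case 0
  then show ?case by (auto intro: has_real_derivative_continuous_on)
next
  case (Suc k)
  then show ?case by (metis smooth_upto.simps(2))
qed

lemma smooth_upto_add: "smooth_upto k f \<Longrightarrow> smooth_upto k g \<Longrightarrow> smooth_upto k (\<lambda>x. f x + g x)"
proof (induction k arbitrary: f g)
  case 0
  then show ?case by (auto intro: continuous_intros)
next
  case (Suc k)
  then obtain f' g' where "\<And>x. (f has_real_derivative f' x) (at x)" "smooth_upto k f'"
    "\<And>x. (g has_real_derivative g' x) (at x)" "smooth_upto k g'" by auto
  then show ?case
    by (intro smooth_upto_SucI[where f' = "\<lambda>x. f' x + g' x"] Suc.IH DERIV_add)
qed

lemma smooth_upto_mult: "smooth_upto k f \<Longrightarrow> smooth_upto k g \<Longrightarrow> smooth_upto k (\<lambda>x. f x * g x)"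
proof (induction k arbitrary: f g)
  case 0
  then show ?case by (auto intro: continuous_intros)
next
  case (Suc k)
  then obtain f' g' where "\<And>x. (f has_real_derivative f' x) (at x)" "smooth_upto k f'"
    "\<And>x. (g has_real_derivative g' x) (at x)" "smooth_upto k g'" by auto
  then show ?case
    using Suc.prems[THEN smooth_upto_Suc_D]
    by (intro smooth_upto_SucI[where f' = "\<lambda>x. f' x * g x + g' x * f x"] smooth_upto_add Suc.IH
        DERIV_mult)
qed

lemma smooth_upto_const: "smooth_upto k (\<lambda>x. c)"
proof (induction k arbitrary: c)
  case (Suc k)
  show ?case by (rule smooth_upto_SucI[OF DERIV_const Suc])
qed simp

lemma smooth_upto_affine: "smooth_upto k f \<Longrightarrow> smooth_upto k (\<lambda>x. f (c * x + d))"
proof (induction k arbitrary: f)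
  case 0
  then show ?case
    by (auto intro!: continuous_on_compose2[of UNIV f] continuous_intros)
next
  case (Suc k)
  then obtain f' where f': "\<And>x. (f has_real_derivative f' x) (at x)" "smooth_upto k f'" by auto
  have "((\<lambda>x. f (c * x + d)) has_real_derivative f' (c * x + d) * c) (at x)" for x
    by (rule DERIV_chain2[OF f'(1)]) (auto intro!: derivative_eq_intros)
  then show ?case
    by (rule smooth_upto_SucI) (intro smooth_upto_mult smooth_upto_const Suc.IH f'(2))
qed

lemma smooth_upto_sin_cos: "smooth_upto k sin \<and> smooth_upto k cos"
proof (induction k)
  case 0
  then show ?case by (auto intro: continuous_intros)
next
  case (Suc k)
  have "smooth_upto k (\<lambda>x. - sin x)"
    using smooth_upto_mult[OF smooth_upto_const[of k "-1"], of sin] Suc by simp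
  with Suc show ?case
    by (auto intro!: smooth_upto_SucI intro: DERIV_sin DERIV_cos)
qed

section \<open>Tensor products of one-variable functions\<close>

lemma tensor_has_derivative:
  assumes a: "\<And>x. (a has_real_derivative a' x) (at x)" and b: "\<And>x. (b has_real_derivative b' x) (at x)"
  shows "((\<lambda>p. a (fst p) * b (snd p)) has_derivative
    (\<lambda>h. a (fst p) * (b' (snd p) * snd h) + a' (fst p) * fst h * b (snd p))) (at p)"
proof (rule has_derivative_mult)
  show "((\<lambda>p. a (fst p)) has_derivative (\<lambda>h. a' (fst p) * fst h)) (at p)"
    by (rule has_derivative_compose[OF has_derivative_fst[OF has_derivative_ident]])
      (use a in \<open>simp add: has_field_derivative_def\<close>)
  show "((\<lambda>p. b (snd p)) has_derivative (\<lambda>h. b' (snd p) * snd h)) (at p)"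
    by (rule has_derivative_compose[OF has_derivative_snd[OF has_derivative_ident]])
      (use b in \<open>simp add: has_field_derivative_def\<close>)
qed

lemma partial_tensor:
  assumes "\<And>x. (a has_real_derivative a' x) (at x)" "\<And>x. (b has_real_derivative b' x) (at x)"
  shows "partial (1, 0) (\<lambda>p. a (fst p) * b (snd p)) = (\<lambda>p. a' (fst p) * b (snd p))"
    "partial (0, 1) (\<lambda>p. a (fst p) * b (snd p)) = (\<lambda>p. a (fst p) * b' (snd p))"
  by (simp_all add: partial_eq[OF tensor_has_derivative[OF assms]])

text \<open>The induction closes because both partial derivatives of a tensor product are tensor
  products again.\<close>

lemma C_k_tensor:
  "smooth_upto k a \<Longrightarrow> smooth_upto k b \<Longrightarrow> C_k k (\<lambda>p. a (fst p) * b (snd p))"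
proof (induction k arbitrary: a b)
  case 0
  then show ?case
    by (auto intro!: continuous_intros continuous_on_compose2[of UNIV a] continuous_on_compose2[of UNIV b])
next
  case (Suc k)
  then obtain a' b' where ab: "\<And>x. (a has_real_derivative a' x) (at x)" "smooth_upto k a'"
    "\<And>x. (b has_real_derivative b' x) (at x)" "smooth_upto k b'" by auto
  have "partial (1, 0) (\<lambda>p. a (fst p) * b (snd p)) = (\<lambda>p. a' (fst p) * b (snd p))"
    "partial (0, 1) (\<lambda>p. a (fst p) * b (snd p)) = (\<lambda>p. a (fst p) * b' (snd p))"
    using partial_tensor[OF ab(1,3)] by simp_all
  moreover have "(\<lambda>p. a (fst p) * b (snd p)) differentiable_on UNIV"
    using tensor_has_derivative[OF ab(1,3)] by (auto simp: differentiable_on_def differentiable_def)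
  ultimately show ?case
    using ab Suc.IH Suc.prems[THEN smooth_upto_Suc_D] by (auto simp: Basis_prod_def)
qed

section \<open>Smooth cutoffs built from exp(-1/t)\<close>

text \<open>The classical function exp(-1/t), extended by zero; the powers of 1/t are included so
  that the derivatives are linear combinations of members of the same family.\<close>

definition flat :: "nat \<Rightarrow> real \<Rightarrow> real" where
  "flat j t = (if t > 0 then (1 / t) ^ j * exp (- (1 / t)) else 0)"

text \<open>A single term of the exponential series is at most \<open>exp s\<close>.\<close>

lemma power_exp_minus_le:
  fixes s :: real
  assumes "0 \<le> s"
  shows "s ^ n * exp (- s) \<le> fact n"
proof -
  have "s ^ n / fact n \<le> (\<Sum>i\<le>n. s ^ i / fact i)"
    using assms by (intro member_le_sum) auto
  also have "\<dots> \<le> exp s"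
  proof -
    have "(\<Sum>i\<le>n. s ^ i /\<^sub>R fact i) \<le> (\<Sum>i. s ^ i /\<^sub>R fact i)"
      using assms by (intro sum_le_suminf summable_exp_generic) (auto intro: divide_nonneg_nonneg)
    then show ?thesis by (simp add: exp_def divide_inverse mult.commute)
  qed
  finally show ?thesis
    by (simp add: exp_minus field_simps)
qed

lemma flat_nonneg: "0 \<le> flat j t"
  by (simp add: flat_def)

lemma flat_le_fact: "flat j t \<le> fact j"
  using power_exp_minus_le[of "1 / t" j] by (simp add: flat_def)

lemma flat_le_one: "flat 0 t \<le> 1"
  using flat_le_fact[of 0] by simp

text \<open>Also valid for nonpositive \<open>t\<close>, where both sides are 0. It trades a
  division by \<open>t\<close> for a higher index, both in the difference quotient at 0 and in the
  bound on \<open>bump_deriv\<close>.\<close>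

lemma flat_Suc: "flat j t = t * flat (Suc j) t"
  by (simp add: flat_def)

lemma DERIV_eventually_cong:
  "eventually (\<lambda>t. f t = g t) (nhds x) \<Longrightarrow> (g has_real_derivative D) (at x) \<Longrightarrow>
    (f has_real_derivative D) (at x)"
  using DERIV_cong_ev[OF refl, of f g x D D] by simp

lemma flat_has_derivative:
  "(flat j has_real_derivative flat (j + 2) t - real j * flat (j + 1) t) (at t)"
proof (cases t "0 :: real" rule: linorder_cases)
  case greater
  \<comment> \<open>On the positive side the formula is the chain rule for
    \<open>s ^ j * exp (- s)\<close> at \<open>s = 1 / t\<close>.\<close>
  have "((\<lambda>s. s ^ j * exp (- s)) has_real_derivative
      real j * (1 / t) ^ (j - 1) * exp (- (1 / t)) - (1 / t) ^ j * exp (- (1 / t))) (at (1 / t))"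
    by (auto intro!: derivative_eq_intros)
  moreover have "((\<lambda>t. 1 / t) has_real_derivative - ((1 / t)\<^sup>2)) (at t)"
    using greater by (auto intro!: derivative_eq_intros simp: power2_eq_square)
  ultimately have "((\<lambda>t. (1 / t) ^ j * exp (- (1 / t))) has_real_derivative
      (real j * (1 / t) ^ (j - 1) * exp (- (1 / t)) - (1 / t) ^ j * exp (- (1 / t))) * - ((1 / t)\<^sup>2)) (at t)"
    by (rule DERIV_chain2)
  moreover have "(real j * (1 / t) ^ (j - 1) * exp (- (1 / t)) - (1 / t) ^ j * exp (- (1 / t))) * - ((1 / t)\<^sup>2)
      = flat (j + 2) t - real j * flat (j + 1) t"
    using greater by (cases j) (simp_all add: flat_def power2_eq_square algebra_simps add_divide_distrib)
  ultimately have D: "((\<lambda>t. (1 / t) ^ j * exp (- (1 / t))) has_real_derivative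
      flat (j + 2) t - real j * flat (j + 1) t) (at t)" by simp
  have E: "eventually (\<lambda>t. flat j t = (1 / t) ^ j * exp (- (1 / t))) (nhds t)"
    using eventually_nhds_in_open[of "{0<..}" t] greater by (auto elim!: eventually_mono simp: flat_def)
  show ?thesis
    by (rule DERIV_eventually_cong[OF E D])
next
  case less
  have "eventually (\<lambda>t. flat j t = 0) (nhds t)"
    using eventually_nhds_in_open[of "{..<0}" t] less by (auto elim!: eventually_mono simp: flat_def)
  moreover have "((\<lambda>t. 0) has_real_derivative flat (j + 2) t - real j * flat (j + 1) t) (at t)"
    using less by (simp add: flat_def)
  ultimately show ?thesis
    by (rule DERIV_eventually_cong)
next
  case equal
  \<comment> \<open>The difference quotient at 0 is \<open>flat (Suc j) h\<close>; applying
    \<open>flat_Suc\<close> once more bounds it by \<open>\<bar>h\<bar>\<close> times a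
    factorial.\<close>
  have "(\<lambda>h. flat (Suc j) h) \<midarrow>0\<rightarrow> 0"
  proof (rule tendsto_0_le[where K = "fact (Suc (Suc j))" and f = "\<lambda>h. h"])
    show "\<forall>\<^sub>F h in at 0. norm (flat (Suc j) h) \<le> norm h * fact (Suc (Suc j))"
      using flat_le_fact[of "Suc (Suc j)"] flat_nonneg[of "Suc (Suc j)"]
      by (intro always_eventually allI) (simp add: flat_Suc[of "Suc j"] abs_mult mult_left_mono del: fact_Suc)
  qed (auto intro: tendsto_ident_at)
  then have "(\<lambda>h. (flat j (0 + h) - flat j 0) / h) \<midarrow>0\<rightarrow> 0"
    by (rule Lim_transform_eventually) (auto simp: eventually_at_filter flat_Suc[of j] flat_def)
  then show ?thesis
    using equal by (simp add: DERIV_def flat_def)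
qed

lemma smooth_upto_flat: "smooth_upto k (flat j)"
proof (induction k arbitrary: j)
  case 0
  then show ?case by (auto intro: has_real_derivative_continuous_on flat_has_derivative)
next
  case (Suc k)
  have "smooth_upto k (\<lambda>t. flat (j + 2) t + (- real j) * flat (j + 1) t)"
    by (intro smooth_upto_add smooth_upto_mult smooth_upto_const Suc)
  then show ?case
    using flat_has_derivative by (intro smooth_upto_SucI) auto
qed

text \<open>The shift by 1 makes the support compact in the open interval from l to r; the linear scaling by k
  keeps the derivative times the distance to the endpoints bounded uniformly in k.\<close>

definition bump :: "real \<Rightarrow> real \<Rightarrow> nat \<Rightarrow> real \<Rightarrow> real" where
  "bump l r k x = flat 0 (real k * (x - l) - 1) * flat 0 (real k * (r - x) - 1)"

definition bump_deriv :: "real \<Rightarrow> real \<Rightarrow> nat \<Rightarrow> real \<Rightarrow> real" where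
  "bump_deriv l r k x =
     real k * flat 2 (real k * (x - l) - 1) * flat 0 (real k * (r - x) - 1) -
     flat 0 (real k * (x - l) - 1) * (real k * flat 2 (real k * (r - x) - 1))"

lemma smooth_upto_bump: "smooth_upto j (bump l r k)"
proof -
  have "bump l r k = (\<lambda>x. flat 0 (real k * x + (- real k * l - 1)) * flat 0 (- real k * x + (real k * r - 1)))"
    by (auto simp: bump_def algebra_simps)
  then show ?thesis
    by (simp only:) (intro smooth_upto_mult smooth_upto_affine smooth_upto_flat)
qed

lemma bump_has_derivative: "(bump l r k has_real_derivative bump_deriv l r k x) (at x)"
proof -
  have "((\<lambda>x. flat 0 (real k * (x - l) - 1)) has_real_derivative
      flat 2 (real k * (x - l) - 1) * real k) (at x)"
    by (rule DERIV_chain2[where f = "flat 0"])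
      (use flat_has_derivative[of 0] in \<open>auto intro!: derivative_eq_intros simp: numeral_2_eq_2\<close>)
  moreover have "((\<lambda>x. flat 0 (real k * (r - x) - 1)) has_real_derivative
      flat 2 (real k * (r - x) - 1) * (- real k)) (at x)"
    by (rule DERIV_chain2[where f = "flat 0"])
      (use flat_has_derivative[of 0] in \<open>auto intro!: derivative_eq_intros simp: numeral_2_eq_2\<close>)
  ultimately show ?thesis
    unfolding bump_def [abs_def] bump_deriv_def
    by (auto intro!: derivative_eq_intros)
qed

text \<open>The margin is \<open>1 / (k + 1)\<close> rather than \<open>1 / k\<close>, which keeps
  it positive for \<open>k = 0\<close> too; raising \<open>k\<close> to \<open>Suc k\<close> is
  harmless because \<open>x\<close> lies strictly between \<open>l\<close> and
  \<open>r\<close>.\<close>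

lemma bump_nonzero:
  assumes "bump l r k x \<noteq> 0"
  shows "l + 1 / real (Suc k) \<le> x" "x \<le> r - 1 / real (Suc k)"
proof -
  have "real k * (x - l) > 1" "real k * (r - x) > 1"
    using assms by (auto simp: bump_def flat_def split: if_splits)
  moreover from this have "k > 0" "x > l" "r > x"
    by (auto intro!: Nat.gr0I simp: zero_less_mult_iff) (smt (verit) mult_nonneg_nonpos of_nat_0_le_iff)+
  ultimately have "real (Suc k) * (x - l) \<ge> 1" "real (Suc k) * (r - x) \<ge> 1"
    by (auto simp: algebra_simps)
  then show "l + 1 / real (Suc k) \<le> x" "x \<le> r - 1 / real (Suc k)"
    by (auto simp: field_simps)
qed

lemma abs_bump_le: "\<bar>bump l r k x\<bar> \<le> 1"
  by (auto simp: bump_def abs_mult flat_nonneg intro!: mult_le_one flat_le_one)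

lemma tensor_test_function:
  assumes "\<And>k. smooth_upto k a" "\<And>k. smooth_upto k b" "0 < d"
    and a: "\<And>x. a x \<noteq> 0 \<Longrightarrow> d \<le> x \<and> x \<le> 1 - d"
    and b: "\<And>x. b x \<noteq> 0 \<Longrightarrow> d \<le> x \<and> x \<le> 1 - d"
  shows "(\<lambda>p. a (fst p) * b (snd p)) \<in> test_functions unit_square"
proof -
  let ?K = "{d..1 - d} \<times> {d..1 - d}"
  have "compact ?K" by (intro compact_Times compact_Icc)
  moreover have "{p. a (fst p) * b (snd p) \<noteq> 0} \<subseteq> ?K"
    using a b by auto
  ultimately have "closure {p. a (fst p) * b (snd p) \<noteq> 0} \<subseteq> ?K"
    by (intro closure_minimal compact_imp_closed)
  moreover have "?K \<subseteq> unit_square"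
    using \<open>0 < d\<close> by (auto simp: unit_square_def)
  ultimately show ?thesis
    using \<open>compact ?K\<close> assms(1,2) compact_Int_closed[of ?K "closure {p. a (fst p) * b (snd p) \<noteq> 0}"]
    by (auto simp: test_functions_def C_k_tensor Int_absorb1)
qed

text \<open>The limit \<open>0 ^ j\<close> is 1 for \<open>j = 0\<close> and 0 otherwise, so one
  statement serves both the cutoff and the terms of its derivative.\<close>

lemma flat_tendsto: "(flat j \<longlongrightarrow> 0 ^ j) at_top"
proof (rule Lim_transform_eventually)
  have "((\<lambda>t. 1 / t :: real) \<longlongrightarrow> 0) at_top"
    using tendsto_inverse_0_at_top[OF filterlim_ident] by (simp add: inverse_eq_divide)
  then have "((\<lambda>t. (1 / t :: real) ^ j * exp (- (1 / t))) \<longlongrightarrow> 0 ^ j * exp (- 0)) at_top"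
    by (intro tendsto_intros)
  then show "((\<lambda>t. (1 / t :: real) ^ j * exp (- (1 / t))) \<longlongrightarrow> 0 ^ j) at_top"
    by simp
  show "\<forall>\<^sub>F t in at_top. (1 / t) ^ j * exp (- (1 / t)) = flat j t"
    using eventually_gt_at_top[of 0] by eventually_elim (simp add: flat_def)
qed

lemma flat_affine_tendsto:
  assumes "0 < c"
  shows "(\<lambda>k. flat j (real k * c - 1)) \<longlonglongrightarrow> 0 ^ j"
proof (rule filterlim_compose[OF flat_tendsto])
  have "filterlim (\<lambda>k. c * real k) at_top sequentially"
    by (rule filterlim_tendsto_pos_mult_at_top[OF tendsto_const assms filterlim_real_sequentially])
  from filterlim_tendsto_add_at_top[OF tendsto_const[of "-1"] this]
  show "filterlim (\<lambda>k. real k * c - 1) at_top sequentially"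
    by (simp add: mult.commute)
qed

lemma bump_tendsto: "(\<lambda>k. bump l r k x) \<longlonglongrightarrow> indicator {l<..<r} x"
proof (cases "l < x \<and> x < r")
  case True
  then have "(\<lambda>k. bump l r k x) \<longlonglongrightarrow> 0 ^ 0 * 0 ^ 0"
    unfolding bump_def by (intro tendsto_mult flat_affine_tendsto) auto
  then show ?thesis using True by simp
next
  case False
  have "bump l r k x = 0" for k
  proof (rule ccontr)
    assume "bump l r k x \<noteq> 0"
    from bump_nonzero[OF this] have "l + 1 / real (Suc k) \<le> x" "x \<le> r - 1 / real (Suc k)" .
    moreover have "0 < 1 / real (Suc k)" by simp
    ultimately have "l < x" "x < r" by linarith+
    with False show False by simp
  qed
  with False show ?thesis by simp
qed

text \<open>Put \<open>t = k * c - 1\<close>. Then \<open>k * c = t + 1\<close>, and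
  \<open>t * flat 2 t = flat 1 t\<close>. The factor \<open>k\<close> thus turns into the inverse
  distance \<open>1 / c\<close> times a bounded quantity.\<close>

lemma bump_deriv_factor:
  assumes "0 < c"
  shows "real k * flat 2 (real k * c - 1) = (flat 1 (real k * c - 1) + flat 2 (real k * c - 1)) / c"
  using assms flat_Suc[of 1 "real k * c - 1"] by (simp add: field_simps numeral_2_eq_2)

lemma bump_deriv_tendsto:
  assumes "l < x" "x < r"
  shows "(\<lambda>k. bump_deriv l r k x) \<longlonglongrightarrow> 0"
proof -
  have lim: "(\<lambda>k. real k * flat 2 (real k * c - 1)) \<longlonglongrightarrow> 0" if "0 < c" for c
  proof -
    have "(\<lambda>k. (flat 1 (real k * c - 1) + flat 2 (real k * c - 1)) / c) \<longlonglongrightarrow> (0 ^ 1 + 0 ^ 2) / c"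
      using that by (intro tendsto_intros flat_affine_tendsto) auto
    then show ?thesis by (simp add: bump_deriv_factor[OF that])
  qed
  have "(\<lambda>k. bump_deriv l r k x) \<longlonglongrightarrow> 0 * 0 ^ 0 - 0 ^ 0 * 0"
    unfolding bump_deriv_def using assms by (intro tendsto_intros lim flat_affine_tendsto) auto
  then show ?thesis by simp
qed

text \<open>A factor \<open>s\<close> that vanishes linearly at both endpoints absorbs the inverse
  distance. Each of the two terms of the derivative contributes at most \<open>3 * c\<close>, from
  \<open>flat 1 \<le> 1\<close> and \<open>flat 2 \<le> 2\<close>.\<close>

lemma bump_deriv_bound:
  assumes x: "l < x" "x < r" and s: "\<bar>s\<bar> \<le> c * (x - l)" "\<bar>s\<bar> \<le> c * (r - x)"
  shows "\<bar>s * bump_deriv l r k x\<bar> \<le> 6 * c"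
proof -
  have *: "\<bar>s\<bar> * (real k * flat 2 (real k * d - 1)) \<le> 3 * c" if "0 < d" "\<bar>s\<bar> \<le> c * d" for d
  proof -
    have "0 \<le> c" using that by (smt (verit) zero_le_mult_iff)
    have "\<bar>s\<bar> * (real k * flat 2 (real k * d - 1)) \<le> c * d * (real k * flat 2 (real k * d - 1))"
      using that by (intro mult_right_mono) (auto simp: flat_nonneg)
    also have "\<dots> = c * (flat 1 (real k * d - 1) + flat 2 (real k * d - 1))"
      using that by (simp add: bump_deriv_factor)
    also have "\<dots> \<le> c * (1 + 2)"
      using flat_le_fact[of 1 "real k * d - 1"] flat_le_fact[of 2 "real k * d - 1"] \<open>0 \<le> c\<close>
      by (intro mult_left_mono add_mono) (auto simp: numeral_2_eq_2)
    finally show ?thesis by (simp add: mult.commute)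
  qed
  have **: "\<bar>s\<bar> * (real k * flat 2 (real k * d - 1)) * flat 0 y \<le> 3 * c"
    if "0 < d" "\<bar>s\<bar> \<le> c * d" for d y
    using mult_mono[OF *[OF that] flat_le_one[of y]] that
    by (smt (verit) flat_nonneg mult_nonneg_nonneg of_nat_0_le_iff abs_ge_zero * mult.right_neutral)
  have "\<bar>s * bump_deriv l r k x\<bar> \<le>
      \<bar>s\<bar> * (real k * flat 2 (real k * (x - l) - 1)) * flat 0 (real k * (r - x) - 1) +
      \<bar>s\<bar> * (real k * flat 2 (real k * (r - x) - 1)) * flat 0 (real k * (x - l) - 1)"
    unfolding bump_deriv_def right_diff_distrib
    by (rule order_trans[OF abs_triangle_ineq4]) (simp add: abs_mult flat_nonneg mult_ac)
  also have "\<dots> \<le> 3 * c + 3 * c"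
    using assms by (intro add_mono **) auto
  finally show ?thesis by simp
qed

section \<open>Continuously differentiable functions and test functions on the square\<close>

lemma C_k_Suc_D: "C_k (Suc k) f \<Longrightarrow> C_k k f"
proof (induction k arbitrary: f)
  case 0
  then show ?case by (auto intro: differentiable_imp_continuous_on)
qed auto

lemma C_1_continuous: "C_k 1 f \<Longrightarrow> continuous_on UNIV f"
  using C_k_Suc_D[of 0 f] by simp

lemma C_1_partial_continuous: "C_k 1 f \<Longrightarrow> v \<in> Basis \<Longrightarrow> continuous_on UNIV (partial v f)"
  by simp

lemma C_1_has_derivative:
  assumes "C_k 1 f"
  shows "(f has_derivative (\<lambda>h. fst h * partial (1, 0) f p + snd h * partial (0, 1) f p)) (at p)"
proof -
  let ?D = "frechet_derivative f (at p)"
  have D: "(f has_derivative ?D) (at p)"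
    using assms by (simp add: differentiable_on_def flip: frechet_derivative_works del: split_paired_All)
  then have lin: "linear ?D" by (rule has_derivative_linear)
  have "?D h = fst h * ?D (1, 0) + snd h * ?D (0, 1)" for h
  proof -
    have "?D h = ?D (fst h *\<^sub>R (1, 0) + snd h *\<^sub>R (0, 1))"
      by (cases h) simp
    also have "\<dots> = fst h * ?D (1, 0) + snd h * ?D (0, 1)"
      by (simp only: linear_add[OF lin] linear_scale[OF lin] real_scaleR_def)
    finally show ?thesis .
  qed
  then have "?D = (\<lambda>h. fst h * partial (1, 0) f p + snd h * partial (0, 1) f p)"
    unfolding partial_def by (rule ext)
  with D show ?thesis by simp
qed

lemma partial_mult:
  assumes "C_k 1 f" "C_k 1 g" "v \<in> Basis"
  shows "partial v (\<lambda>p. f p * g p) = (\<lambda>p. f p * partial v g p + partial v f p * g p)"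
  using assms(3)
  by (auto simp: Basis_prod_def partial_eq[OF has_derivative_mult[OF C_1_has_derivative[OF assms(1)]
        C_1_has_derivative[OF assms(2)]]])

lemma C_1_mult:
  assumes "C_k 1 f" "C_k 1 g"
  shows "C_k 1 (\<lambda>p. f p * g p)"
proof -
  have "continuous_on UNIV (partial v (\<lambda>p. f p * g p))" if "v \<in> Basis" for v
    unfolding partial_mult[OF assms that] using assms that
    by (intro continuous_intros C_1_continuous C_1_partial_continuous)
  moreover have "(\<lambda>p. f p * g p) differentiable_on UNIV"
    using assms by (auto intro: differentiable_on_mult)
  ultimately show ?thesis by simp
qed

lemma C_1_slice_derivatives:
  assumes "C_k 1 f"
  shows "((\<lambda>x. f (x, y)) has_real_derivative partial (1, 0) f (x, y)) (at x)"
    and "((\<lambda>y. f (x, y)) has_real_derivative partial (0, 1) f (x, y)) (at y)"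
proof -
  have "((\<lambda>x. f (x, y)) has_derivative
      (\<lambda>h. fst (h, 0::real) * partial (1, 0) f (x, y) + snd (h, 0::real) * partial (0, 1) f (x, y))) (at x)"
    by (rule has_derivative_compose[OF _ C_1_has_derivative[OF assms]]) (auto intro!: derivative_eq_intros)
  then show "((\<lambda>x. f (x, y)) has_real_derivative partial (1, 0) f (x, y)) (at x)"
    by (simp add: has_field_derivative_def mult_commute_abs)
  have "((\<lambda>y. f (x, y)) has_derivative
      (\<lambda>h. fst (0::real, h) * partial (1, 0) f (x, y) + snd (0::real, h) * partial (0, 1) f (x, y))) (at y)"
    by (rule has_derivative_compose[OF _ C_1_has_derivative[OF assms]]) (auto intro!: derivative_eq_intros)
  then show "((\<lambda>y. f (x, y)) has_real_derivative partial (0, 1) f (x, y)) (at y)"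
    by (simp add: has_field_derivative_def mult_commute_abs)
qed

text \<open>Both orders of integration are provided, so that a partial derivative can be integrated
  first in its own variable.\<close>

lemma integral_lsq_eq:
  fixes f :: "plane \<Rightarrow> real"
  assumes "continuous_on UNIV f"
  shows "(LINT p|lsq. f p) = integral {0..1} (\<lambda>x. integral {0..1} (\<lambda>y. f (x, y)))"
    and "(LINT p|lsq. f p) = integral {0..1} (\<lambda>y. integral {0..1} (\<lambda>x. f (x, y)))"
proof -
  have c: "continuous_on A f" for A
    using assms continuous_on_subset by blast
  have "(LINT p|lsq. f p) = integral unit_square f"
    using L2_integrable[OF continuous_L2[OF assms]]
    by (intro lebesgue_integral_eq_integral) (simp_all add: unit_square_eq_box)
  also have "\<dots> = integral (cbox (0, 0) (1, 1)) f"
    by (simp add: unit_square_eq_box integral_open_interval)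
  also have "\<dots> = integral (cbox 0 1) (\<lambda>x. integral (cbox 0 1) (\<lambda>y. f (x, y)))"
    using c by (rule integral_prod_continuous)
  finally show 1: "(LINT p|lsq. f p) = integral {0..1} (\<lambda>x. integral {0..1} (\<lambda>y. f (x, y)))"
    by simp
  have "integral (cbox 0 1) (\<lambda>x. integral (cbox 0 1) (\<lambda>y. f (x, y))) =
      integral (cbox 0 1) (\<lambda>y. integral (cbox 0 1) (\<lambda>x. f (x, y)))"
    by (rule integral_swap_continuous) (use c in simp)
  then show "(LINT p|lsq. f p) = integral {0..1} (\<lambda>y. integral {0..1} (\<lambda>x. f (x, y)))"
    using 1 by simp
qed

text \<open>On each line parallel to \<open>v\<close> the fundamental theorem of calculus leaves
  only the values on the boundary, which are 0.\<close>

lemma integral_partial_eq_0: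
  assumes F: "C_k 1 F" and zero: "\<And>p. p \<notin> unit_square \<Longrightarrow> F p = 0" and v: "v \<in> Basis"
  shows "(LINT p|lsq. partial v F p) = 0"
proof -
  have ftc: "integral {0..1} f' = 0"
    if "\<And>x. (f has_real_derivative f' x) (at x)" "f 0 = 0" "f 1 = 0" for f f' :: "real \<Rightarrow> real"
  proof -
    have "(f' has_integral (f 1 - f 0)) {0..1}"
      by (rule fundamental_theorem_of_calculus)
        (use that in \<open>auto simp: has_real_derivative_iff_has_vector_derivative[symmetric]
          intro: has_field_derivative_at_within\<close>)
    then show ?thesis using that by (simp add: integral_unique)
  qed
  have "integral {0..1} (\<lambda>x. partial (1, 0) F (x, y)) = 0"
    "integral {0..1} (\<lambda>y. partial (0, 1) F (x, y)) = 0" for x y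
    by (rule ftc[OF C_1_slice_derivatives(1)[OF F]] ftc[OF C_1_slice_derivatives(2)[OF F]];
        simp add: zero mem_unit_square)+
  moreover have "v = (1, 0) \<or> v = (0, 1)"
    using v by (auto simp: Basis_prod_def)
  ultimately show ?thesis
    using integral_lsq_eq[OF C_1_partial_continuous[OF F v]] by auto
qed

lemma test_functions_C_k: "\<psi> \<in> test_functions S \<Longrightarrow> C_k k \<psi>"
  by (auto simp: test_functions_def)

lemma test_functions_eq_0: "\<psi> \<in> test_functions S \<Longrightarrow> p \<notin> S \<Longrightarrow> \<psi> p = 0"
  using closure_subset[of "{p. \<psi> p \<noteq> 0}"] by (auto simp: test_functions_def)

lemma test_functions_L2: "\<psi> \<in> test_functions S \<Longrightarrow> \<psi> \<in> L2 unit_square"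
  by (rule continuous_L2) (use test_functions_C_k[of \<psi> S 0] in simp)

lemma test_functions_partial:
  assumes \<psi>: "\<psi> \<in> test_functions S" and v: "v \<in> Basis"
  shows "partial v \<psi> \<in> test_functions S"
proof -
  let ?K = "closure {p. \<psi> p \<noteq> 0}"
  have "partial v \<psi> p = 0" if "p \<notin> ?K" for p
  proof -
    have "(\<psi> has_derivative (\<lambda>h. 0)) (at p)"
      by (rule has_derivative_transform_within_open[of "\<lambda>p. 0" _ _ _ "- ?K"])
        (use that closure_subset[of "{p. \<psi> p \<noteq> 0}"] in auto)
    then show ?thesis by (simp add: partial_def frechet_derivative_at[symmetric])
  qed
  then have "closure {p. partial v \<psi> p \<noteq> 0} \<subseteq> ?K"
    by (intro closure_minimal) auto
  moreover have "C_k k (partial v \<psi>)" for k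
    using test_functions_C_k[OF \<psi>, of "Suc k"] v by simp
  moreover have "compact ?K" "?K \<subseteq> S"
    using \<psi> by (auto simp: test_functions_def)
  ultimately show ?thesis
    using compact_Int_closed[of ?K "closure {p. partial v \<psi> p \<noteq> 0}"]
    by (auto simp: test_functions_def Int_absorb1)
qed

text \<open>The product \<open>f * \<psi>\<close> vanishes outside the square even though
  \<open>f\<close> may not, so the integral of its partial derivative is 0.\<close>

lemma L2_inner_by_parts:
  assumes f: "C_k 1 f" and \<psi>: "\<psi> \<in> test_functions unit_square" and v: "v \<in> Basis"
  shows "L2_inner unit_square f (partial v \<psi>) = - L2_inner unit_square (partial v f) \<psi>"
proof -
  note \<psi>1 = test_functions_C_k[OF \<psi>, of 1]
  have L2: "f \<in> L2 unit_square" "partial v f \<in> L2 unit_square"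
    by (intro continuous_L2 C_1_continuous C_1_partial_continuous f v)+
  have "(LINT p|lsq. partial v (\<lambda>p. f p * \<psi> p) p) = 0"
    using integral_partial_eq_0[OF C_1_mult[OF f \<psi>1] _ v] test_functions_eq_0[OF \<psi>] by simp
  then show ?thesis
    using L2 \<psi> test_functions_partial[OF \<psi> v]
    by (simp add: partial_mult[OF f \<psi>1 v] L2_integrable_mult test_functions_L2 L2_inner_def)
qed

section \<open>Uniqueness of weak derivatives\<close>

lemma bounded_measurable_L2:
  assumes "f \<in> borel_measurable lsq" "\<And>p. \<bar>f p\<bar> \<le> B"
  shows "f \<in> L2 unit_square"
proof -
  have "integrable lsq (\<lambda>p. (f p)\<^sup>2)"
    by (rule finite_measure.integrable_const_bound[OF finite_measure_lsq, of _ "B\<^sup>2"])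
      (use assms(1) order_trans[OF assms(2) abs_ge_self] in \<open>auto intro!: AE_I2 simp: abs_le_square_iff[symmetric]\<close>)
  then show ?thesis using assms by (simp add: L2_def)
qed

text \<open>Products of bumps are test functions that converge boundedly and pointwise to the
  indicator of the box.\<close>

lemma set_integral_box_eq_0:
  assumes v: "v \<in> L2 unit_square"
    and orth: "\<And>\<psi>. \<psi> \<in> test_functions unit_square \<Longrightarrow> L2_inner unit_square v \<psi> = 0"
  shows "(LINT p|lsq. v p * indicator (box a b) p) = 0"
proof -
  \<comment> \<open>The box is clipped to the unit square to make the bumps admissible; inside the
    square its indicator is unchanged.\<close>
  define l1 r1 l2 r2 where "l1 = max 0 (fst a)" "r1 = min 1 (fst b)" "l2 = max 0 (snd a)" "r2 = min 1 (snd b)"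
  define F where "F k p = bump l1 r1 k (fst p) * bump l2 r2 k (snd p)" for k and p :: plane
  have test: "F k \<in> test_functions unit_square" for k
    unfolding F_def[abs_def]
  proof (rule tensor_test_function[where d = "1 / real (Suc k)"])
    fix x
    show "1 / real (Suc k) \<le> x \<and> x \<le> 1 - 1 / real (Suc k)" if "bump l1 r1 k x \<noteq> 0"
      using bump_nonzero[OF that] by (auto simp: l1_r1_l2_r2_def max_def min_def split: if_splits)
    show "1 / real (Suc k) \<le> x \<and> x \<le> 1 - 1 / real (Suc k)" if "bump l2 r2 k x \<noteq> 0"
      using bump_nonzero[OF that] by (auto simp: l1_r1_l2_r2_def max_def min_def split: if_splits)
  qed (simp_all add: smooth_upto_bump)
  have "(\<lambda>k. L2_inner unit_square v (F k)) \<longlonglongrightarrow> L2_inner unit_square v (indicator (box a b))"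
  proof (rule L2_inner_dominated[OF v, where B = 1])
    show "F k \<in> L2 unit_square" for k
      by (rule test_functions_L2[OF test])
    have "box a b \<in> sets lebesgue" by simp
    then have "(indicator (box a b) :: plane \<Rightarrow> real) \<in> borel_measurable lsq"
      by (intro measurable_restrict_space1 borel_measurable_indicator)
    then show "indicator (box a b) \<in> L2 unit_square"
      by (rule bounded_measurable_L2[where B = 1]) (simp split: split_indicator)
    show "(\<lambda>k. F k p) \<longlonglongrightarrow> indicator (box a b) p" if "p \<in> unit_square" for p
    proof -
      have "(\<lambda>k. F k p) \<longlonglongrightarrow> indicator {l1<..<r1} (fst p) * indicator {l2<..<r2} (snd p)"
        unfolding F_def by (intro tendsto_mult bump_tendsto)
      moreover have "indicator {l1<..<r1} (fst p) * indicator {l2<..<r2} (snd p) = (indicator (box a b) p :: real)"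
        using that by (cases p; cases a; cases b)
          (auto simp: l1_r1_l2_r2_def mem_unit_square mem_box Basis_prod_def split: split_indicator)
      ultimately show ?thesis by simp
    qed
    show "\<bar>F k p\<bar> \<le> 1" for k p
      by (auto simp: F_def abs_mult abs_bump_le intro!: mult_le_one)
  qed
  moreover have "L2_inner unit_square v (F k) = 0" for k
    by (rule orth[OF test])
  ultimately show ?thesis
    by (simp add: LIMSEQ_const_iff L2_inner_def)
qed

text \<open>The integral of \<open>v\<close>, extended by zero to \<open>V\<close>, vanishes over
  boxes. Boxes are stable under intersection and generate the Borel sets, so it vanishes over all
  Borel sets, then over all Lebesgue sets, and the density \<open>V\<close> is 0 almost
  everywhere.\<close>

lemma AE_eq_0_if_orthogonal_test_functions:
  assumes v: "v \<in> L2 unit_square"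
    and orth: "\<And>\<psi>. \<psi> \<in> test_functions unit_square \<Longrightarrow> L2_inner unit_square v \<psi> = 0"
  shows "AE p in lsq. v p = 0"
proof -
  define V where "V = (\<lambda>p. indicator unit_square p * v p)"
  have S: "unit_square \<in> sets lebesgue"
    by (simp add: unit_square_eq_box)
  have V: "integrable lebesgue V"
    using L2_integrable[OF v] S by (simp add: integrable_restrict_space V_def)
  have si: "set_integrable lebesgue A V" if "A \<in> sets borel" for A
    using that V unfolding set_integrable_def by (intro integrable_mult_indicator) auto
  have borel: "(LINT p:A|lebesgue. V p) = 0" if "A \<in> sets borel" for A
  proof -
    have "Int_stable (range (\<lambda>(a, b). box a b :: plane set))"
      by (auto simp: Int_stable_def box_Int_box)
    moreover have "range (\<lambda>(a, b). box a b :: plane set) \<subseteq> Pow UNIV"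
      by simp
    moreover have "A \<in> sigma_sets UNIV (range (\<lambda>(a, b). box a b :: plane set))"
      using that by (simp add: borel_eq_box)
    ultimately show ?thesis
    proof (induction rule: sigma_sets_induct_disjoint)
      case (basic A)
      then obtain a b where A: "A = box a b" by auto
      have "(LINT p:A|lebesgue. V p) = (LINT p|lsq. v p * indicator (box a b) p)"
        using S by (simp add: integral_restrict_space set_lebesgue_integral_def V_def A mult_ac)
      then show ?case
        using set_integral_box_eq_0[OF v orth] by simp
    next
      case empty
      show ?case by (simp add: set_lebesgue_integral_def)
    next
      case (compl A)
      have "A \<in> sets borel" using compl by (simp add: borel_eq_box)
      \<comment> \<open>Complements need the integral over the whole plane, which is the one over
        the box equal to the unit square.\<close>
      have "(LINT p|lebesgue. V p) = (LINT p|lsq. v p * indicator (box (0, 0) (1, 1)) p)"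
        using S by (simp add: integral_restrict_space V_def mult_ac unit_square_eq_box[symmetric]
            flip: indicator_inter_arith)
      also have "\<dots> = 0"
        using set_integral_box_eq_0[OF v orth] by simp
      finally have "(LINT p:UNIV|lebesgue. V p) = 0"
        by (simp add: set_lebesgue_integral_def)
      moreover have "(LINT p:A \<union> (UNIV - A)|lebesgue. V p) = (LINT p:A|lebesgue. V p) + (LINT p:UNIV - A|lebesgue. V p)"
        by (rule set_integral_Un) (use \<open>A \<in> sets borel\<close> si in auto)
      ultimately show ?case using compl by (simp add: Un_absorb1)
    next
      case (union A)
      have A: "A i \<in> sets borel" for i using union by (simp add: borel_eq_box subset_eq)
      have "(LINT p:(\<Union>i. A i)|lebesgue. V p) = (\<Sum>i. (LINT p:A i|lebesgue. V p))"
        by (rule lebesgue_integral_countable_add) (use A union si in \<open>auto simp: disjoint_family_on_def\<close>)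
      then show ?case using union by simp
    qed
  qed
  have "AE p in lebesgue. V p = 0"
  proof (rule density_unique_real[OF V])
    fix A :: "plane set" assume "A \<in> sets lebesgue"
    \<comment> \<open>A Lebesgue set is a Borel set up to part of a Borel null set, which does not
      change the integral.\<close>
    then obtain B N N' where A: "A = B \<union> N" "N \<subseteq> N'" "N' \<in> null_sets lborel" "B \<in> sets lborel"
      by (auto elim: sets_completionE)
    have B: "B \<in> sets lebesgue"
      using A by (intro sets_completionI_sets)
    have "N' \<in> null_sets lebesgue"
      using A by (intro null_sets_completionI)
    then have "AE p in lebesgue. indicator A p *\<^sub>R V p = indicator B p *\<^sub>R V p"
      using AE_not_in[of N' lebesgue] A by (auto elim!: eventually_mono split: split_indicator)
    then have "(LINT p:A|lebesgue. V p) = (LINT p:B|lebesgue. V p)"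
      unfolding set_lebesgue_integral_def
      using \<open>A \<in> sets lebesgue\<close> B V by (intro integral_cong_AE borel_measurable_scaleR borel_measurable_indicator) auto
    then show "(LINT p:A|lebesgue. V p) = (LINT p:A|lebesgue. 0)"
      using borel[of B] A by (simp add: set_lebesgue_integral_def)
  qed simp
  then show ?thesis
    using S by (auto simp: AE_restrict_space_iff V_def elim!: eventually_mono)
qed

lemma has_weak_deriv_unique:
  assumes "has_weak_deriv unit_square \<alpha> u v" "has_weak_deriv unit_square \<alpha> u v'"
  shows "AE p in lsq. v p = v' p"
proof -
  have L2: "v \<in> L2 unit_square" "v' \<in> L2 unit_square"
    using assms by (auto simp: has_weak_deriv_def)
  have "AE p in lsq. v p - v' p = 0"
  proof (rule AE_eq_0_if_orthogonal_test_functions)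
    fix \<psi> assume \<psi>: "\<psi> \<in> test_functions unit_square"
    have "(- 1) ^ (fst \<alpha> + snd \<alpha>) * L2_inner unit_square v \<psi> =
        (- 1) ^ (fst \<alpha> + snd \<alpha>) * L2_inner unit_square v' \<psi>"
      using assms \<psi> by (simp add: has_weak_deriv_def L2_inner_def)
    then have "L2_inner unit_square v \<psi> = L2_inner unit_square v' \<psi>"
      by simp
    then show "L2_inner unit_square (\<lambda>p. v p - v' p) \<psi> = 0"
      using L2 test_functions_L2[OF \<psi>] by (simp add: L2_inner_diff_left)
  qed (intro L2_diff L2)
  then show ?thesis by simp
qed

section \<open>Weak derivatives\<close>

lemma classical_deriv_simps:
  "classical_deriv (0, 0) f = f"
  "classical_deriv (Suc 0, 0) f = partial (1, 0) f" "classical_deriv (0, Suc 0) f = partial (0, 1) f"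
  "classical_deriv (2, 0) f = partial (1, 0) (partial (1, 0) f)"
  "classical_deriv (0, 2) f = partial (0, 1) (partial (0, 1) f)"
  by (simp_all add: classical_deriv_def numeral_2_eq_2)

lemma plane_Basis: "(1, 0) \<in> (Basis :: plane set)" "(0, 1) \<in> (Basis :: plane set)"
  by (simp_all add: Basis_prod_def)

lemma test_functions_classical_deriv:
  assumes "\<psi> \<in> test_functions S"
  shows "classical_deriv \<alpha> \<psi> \<in> test_functions S"
proof -
  have "(partial v ^^ k) \<psi> \<in> test_functions S" if "\<psi> \<in> test_functions S" "v \<in> Basis" for \<psi> v k
    using that by (induction k) (auto intro: test_functions_partial)
  then show ?thesis
    using assms plane_Basis by (simp add: classical_deriv_def)
qed

lemma has_weak_deriv_inner:
  "has_weak_deriv S \<alpha> u v \<Longrightarrow> \<psi> \<in> test_functions S \<Longrightarrow>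
    L2_inner S u (classical_deriv \<alpha> \<psi>) = (- 1) ^ (fst \<alpha> + snd \<alpha>) * L2_inner S v \<psi>"
  by (simp add: has_weak_deriv_def L2_inner_def)

lemma has_weak_derivI:
  "u \<in> L2 S \<Longrightarrow> v \<in> L2 S \<Longrightarrow> (\<And>\<psi>. \<psi> \<in> test_functions S \<Longrightarrow>
    L2_inner S u (classical_deriv \<alpha> \<psi>) = (- 1) ^ (fst \<alpha> + snd \<alpha>) * L2_inner S v \<psi>) \<Longrightarrow>
    has_weak_deriv S \<alpha> u v"
  by (simp add: has_weak_deriv_def L2_inner_def)

lemma has_weak_deriv_L2:
  "has_weak_deriv S \<alpha> u v \<Longrightarrow> u \<in> L2 S" "has_weak_deriv S \<alpha> u v \<Longrightarrow> v \<in> L2 S"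
  by (simp_all add: has_weak_deriv_def)

lemma has_weak_deriv_diff:
  assumes "has_weak_deriv unit_square \<alpha> u v" "has_weak_deriv unit_square \<alpha> u' v'"
  shows "has_weak_deriv unit_square \<alpha> (\<lambda>p. u p - u' p) (\<lambda>p. v p - v' p)"
  using assms[THEN has_weak_deriv_L2(1)] assms[THEN has_weak_deriv_L2(2)]
  by (intro has_weak_derivI L2_diff)
    (simp_all add: L2_inner_diff_left has_weak_deriv_inner[OF assms(1)] has_weak_deriv_inner[OF assms(2)]
      test_functions_L2[of _ unit_square] test_functions_classical_deriv right_diff_distrib)

lemma C_1_has_weak_deriv:
  assumes "C_k 1 f"
  shows "has_weak_deriv unit_square (1, 0) f (partial (1, 0) f)"
    and "has_weak_deriv unit_square (0, 1) f (partial (0, 1) f)"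
proof -
  have L2: "f \<in> L2 unit_square" "v \<in> Basis \<Longrightarrow> partial v f \<in> L2 unit_square" for v
    by (intro continuous_L2 C_1_continuous assms, intro continuous_L2 C_1_partial_continuous assms)
  show "has_weak_deriv unit_square (1, 0) f (partial (1, 0) f)"
    by (rule has_weak_derivI[OF L2(1) L2(2)[OF plane_Basis(1)]])
      (simp add: classical_deriv_simps L2_inner_by_parts[OF assms _ plane_Basis(1)])
  show "has_weak_deriv unit_square (0, 1) f (partial (0, 1) f)"
    by (rule has_weak_derivI[OF L2(1) L2(2)[OF plane_Basis(2)]])
      (simp add: classical_deriv_simps L2_inner_by_parts[OF assms _ plane_Basis(2)])
qed

lemma has_weak_deriv_0: "u \<in> L2 S \<Longrightarrow> has_weak_deriv S (0, 0) u u"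
  by (rule has_weak_derivI) (simp_all add: classical_deriv_simps)

lemma has_weak_deriv_weak_deriv: "has_weak_deriv S \<alpha> u v \<Longrightarrow> has_weak_deriv S \<alpha> u (weak_deriv S \<alpha> u)"
  unfolding weak_deriv_def by (rule someI[of "has_weak_deriv S \<alpha> u"])

lemma sobolev_has_weak_deriv:
  "u \<in> sobolev k S \<Longrightarrow> fst \<alpha> + snd \<alpha> \<le> k \<Longrightarrow> has_weak_deriv S \<alpha> u (weak_deriv S \<alpha> u)"
  unfolding sobolev_def using has_weak_deriv_weak_deriv by blast

lemma L2_norm_AE_cong:
  assumes "f \<in> L2 S" "g \<in> L2 S" "AE p in lebesgue_on S. f p = g p"
  shows "L2_norm S f = L2_norm S g"
  using L2_inner_AE_cong[OF assms(1,2,1,2,3,3)] L2_norm_power2 L2_norm_nonneg power2_eq_imp_eq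
  by metis

text \<open>\<open>weak_deriv\<close> is an arbitrary choice among representatives;
  almost-everywhere uniqueness lets any known weak derivative replace it inside a norm.\<close>

lemma L2_norm_weak_deriv:
  assumes "has_weak_deriv unit_square \<alpha> u v"
  shows "L2_norm unit_square (weak_deriv unit_square \<alpha> u) = L2_norm unit_square v"
  using has_weak_deriv_weak_deriv[OF assms] assms
  by (meson L2_norm_AE_cong has_weak_deriv_L2(2) has_weak_deriv_unique)

text \<open>Stated for a set of multi-indices so that the two pure second derivatives can be bounded
  jointly.\<close>

lemma sum_weak_deriv_le_sobolev_norm:
  assumes "A \<subseteq> {\<alpha>. fst \<alpha> + snd \<alpha> \<le> k}"
  shows "(\<Sum>\<alpha>\<in>A. (L2_norm S (weak_deriv S \<alpha> u))\<^sup>2) \<le> (sobolev_norm k S u)\<^sup>2"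
proof -
  have "finite {\<alpha> :: nat \<times> nat. fst \<alpha> + snd \<alpha> \<le> k}"
    by (rule finite_subset[of _ "{..k} \<times> {..k}"]) auto
  then show ?thesis
    using assms by (simp add: sobolev_norm_def sum_nonneg sum_mono2)
qed

lemma sobolev_norm_nonneg: "0 \<le> sobolev_norm k S u"
  by (simp add: sobolev_norm_def sum_nonneg)

lemma L2_norm_le_sobolev_norm:
  assumes "has_weak_deriv unit_square \<alpha> u v" "fst \<alpha> + snd \<alpha> \<le> k"
  shows "L2_norm unit_square v \<le> sobolev_norm k unit_square u"
  using sum_weak_deriv_le_sobolev_norm[of "{\<alpha>}" k unit_square u] assms
  by (intro power2_le_imp_le[of "L2_norm unit_square v", OF _ sobolev_norm_nonneg])
    (simp add: L2_norm_weak_deriv[OF assms(1)])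

section \<open>Green's formula without boundary term\<close>

text \<open>A dual description of the closure of the test functions in the first-order Sobolev space:
  in contrast to approximability it is visibly closed under linear combinations, and it is the form in
  which membership in that closure is used.\<close>

definition green :: "(plane \<Rightarrow> real) \<Rightarrow> (plane \<Rightarrow> real) \<Rightarrow> (plane \<Rightarrow> real) \<Rightarrow> bool" where
  "green u v1 v2 \<longleftrightarrow> u \<in> L2 unit_square \<and> v1 \<in> L2 unit_square \<and> v2 \<in> L2 unit_square \<and>
     (\<forall>g1\<in>L2 unit_square. \<forall>g2\<in>L2 unit_square. \<forall>h\<in>L2 unit_square.
       (\<forall>\<psi>\<in>test_functions unit_square. L2_inner unit_square g1 (partial (1, 0) \<psi>) +
          L2_inner unit_square g2 (partial (0, 1) \<psi>) = L2_inner unit_square h \<psi>) \<longrightarrow>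
       L2_inner unit_square g1 v1 + L2_inner unit_square g2 v2 = L2_inner unit_square h u)"

lemma green_L2: "green u v1 v2 \<Longrightarrow> u \<in> L2 unit_square \<and> v1 \<in> L2 unit_square \<and> v2 \<in> L2 unit_square"
  by (simp add: green_def)

lemma greenD:
  assumes "green u v1 v2" "g1 \<in> L2 unit_square" "g2 \<in> L2 unit_square" "h \<in> L2 unit_square"
    and "\<And>\<psi>. \<psi> \<in> test_functions unit_square \<Longrightarrow> L2_inner unit_square g1 (partial (1, 0) \<psi>) +
      L2_inner unit_square g2 (partial (0, 1) \<psi>) = L2_inner unit_square h \<psi>"
  shows "L2_inner unit_square g1 v1 + L2_inner unit_square g2 v2 = L2_inner unit_square h u"
  using assms by (auto simp: green_def)

text \<open>For fixed \<open>g1\<close>, \<open>g2\<close>, \<open>h\<close> the identity consists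
  of pairings that are continuous under weak convergence, so it passes from test functions to the
  limit. The modes are reached this way through bounded pointwise limits, elements of
  \<open>H10\<close> through norm limits.\<close>

lemma green_weak_limit:
  assumes L2: "u \<in> L2 unit_square" "v1 \<in> L2 unit_square" "v2 \<in> L2 unit_square"
    and test: "\<And>k. \<psi> k \<in> test_functions unit_square"
    and lim: "\<And>g. g \<in> L2 unit_square \<Longrightarrow> (\<lambda>k. L2_inner unit_square g (\<psi> k)) \<longlonglongrightarrow> L2_inner unit_square g u"
      "\<And>g. g \<in> L2 unit_square \<Longrightarrow>
        (\<lambda>k. L2_inner unit_square g (partial (1, 0) (\<psi> k))) \<longlonglongrightarrow> L2_inner unit_square g v1"
      "\<And>g. g \<in> L2 unit_square \<Longrightarrow>
        (\<lambda>k. L2_inner unit_square g (partial (0, 1) (\<psi> k))) \<longlonglongrightarrow> L2_inner unit_square g v2"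
  shows "green u v1 v2"
proof -
  have "L2_inner unit_square g1 v1 + L2_inner unit_square g2 v2 = L2_inner unit_square h u"
    if g: "g1 \<in> L2 unit_square" "g2 \<in> L2 unit_square" "h \<in> L2 unit_square"
      and eq: "\<forall>\<psi>\<in>test_functions unit_square. L2_inner unit_square g1 (partial (1, 0) \<psi>) +
        L2_inner unit_square g2 (partial (0, 1) \<psi>) = L2_inner unit_square h \<psi>" for g1 g2 h
  proof (rule LIMSEQ_unique[OF _ lim(1)[OF g(3)]])
    show "(\<lambda>k. L2_inner unit_square h (\<psi> k)) \<longlonglongrightarrow> L2_inner unit_square g1 v1 + L2_inner unit_square g2 v2"
      using tendsto_add[OF lim(2)[OF g(1)] lim(3)[OF g(2)]] eq test by simp
  qed
  with L2 show ?thesis by (simp add: green_def)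
qed

lemma green_cmult:
  assumes "green u v1 v2"
  shows "green (\<lambda>p. c * u p) (\<lambda>p. c * v1 p) (\<lambda>p. c * v2 p)"
proof -
  have "L2_inner unit_square g1 (\<lambda>p. c * v1 p) + L2_inner unit_square g2 (\<lambda>p. c * v2 p)
      = L2_inner unit_square h (\<lambda>p. c * u p)"
    if g: "g1 \<in> L2 unit_square" "g2 \<in> L2 unit_square" "h \<in> L2 unit_square"
      and eq: "\<forall>\<psi>\<in>test_functions unit_square. L2_inner unit_square g1 (partial (1, 0) \<psi>) +
        L2_inner unit_square g2 (partial (0, 1) \<psi>) = L2_inner unit_square h \<psi>" for g1 g2 h
  proof -
    have "c * (L2_inner unit_square g1 v1 + L2_inner unit_square g2 v2) = c * L2_inner unit_square h u"
      using greenD[OF assms g] eq by simp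
    then show ?thesis
      by (simp only: L2_inner_cmult_right distrib_left)
  qed
  then show ?thesis
    using green_L2[OF assms] by (simp add: green_def L2_cmult)
qed

lemma green_add:
  assumes "green u v1 v2" "green u' v1' v2'"
  shows "green (\<lambda>p. u p + u' p) (\<lambda>p. v1 p + v1' p) (\<lambda>p. v2 p + v2' p)"
proof -
  note L2 = green_L2[OF assms(1)] green_L2[OF assms(2)]
  have "L2_inner unit_square g1 (\<lambda>p. v1 p + v1' p) + L2_inner unit_square g2 (\<lambda>p. v2 p + v2' p)
      = L2_inner unit_square h (\<lambda>p. u p + u' p)"
    if g: "g1 \<in> L2 unit_square" "g2 \<in> L2 unit_square" "h \<in> L2 unit_square"
      and eq: "\<forall>\<psi>\<in>test_functions unit_square. L2_inner unit_square g1 (partial (1, 0) \<psi>) +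
        L2_inner unit_square g2 (partial (0, 1) \<psi>) = L2_inner unit_square h \<psi>" for g1 g2 h
    using greenD[OF assms(1) g] greenD[OF assms(2) g] eq L2 g
    by (simp add: L2_inner_add_right)
  then show ?thesis
    using L2 by (simp add: green_def L2_add)
qed

lemma green_zero: "green (\<lambda>p. 0) (\<lambda>p. 0) (\<lambda>p. 0)"
  by (simp add: green_def L2_zero L2_inner_zero)

lemma green_sum:
  "(\<And>i. i \<in> I \<Longrightarrow> green (u i) (v1 i) (v2 i)) \<Longrightarrow>
    green (\<lambda>p. \<Sum>i\<in>I. u i p) (\<lambda>p. \<Sum>i\<in>I. v1 i p) (\<lambda>p. \<Sum>i\<in>I. v2 i p)"
  by (induction I rule: infinite_finite_induct) (simp_all add: green_zero green_add)

lemma green_diff: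
  "green u v1 v2 \<Longrightarrow> green u' v1' v2' \<Longrightarrow>
    green (\<lambda>p. u p - u' p) (\<lambda>p. v1 p - v1' p) (\<lambda>p. v2 p - v2' p)"
  using green_add[OF _ green_cmult[of u' v1' v2' "-1"], of u v1 v2] by simp

text \<open>The Sobolev norm of \<open>u - \<psi> k\<close> dominates each of its components. The
  claim ranges over every weak derivative \<open>v\<close>, not only the chosen one, and a single
  sequence serves all multi-indices.\<close>

lemma H10_approx:
  assumes "u \<in> H10 unit_square"
  shows "\<exists>\<psi>. (\<forall>k :: nat. \<psi> k \<in> test_functions unit_square) \<and>
    (\<forall>\<alpha> v. has_weak_deriv unit_square \<alpha> u v \<longrightarrow> fst \<alpha> + snd \<alpha> \<le> 1 \<longrightarrow>
       (\<lambda>k. L2_norm unit_square (\<lambda>p. v p - classical_deriv \<alpha> (\<psi> k) p)) \<longlonglongrightarrow> 0)"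
proof -
  obtain \<psi> where test: "\<And>k. \<psi> k \<in> test_functions unit_square"
    and lim: "(\<lambda>k. sobolev_norm 1 unit_square (\<lambda>p. u p - \<psi> k p)) \<longlonglongrightarrow> 0"
    using assms by (auto simp: H10_def)
  have "(\<lambda>k. L2_norm unit_square (\<lambda>p. v p - classical_deriv \<alpha> (\<psi> k) p)) \<longlonglongrightarrow> 0"
    if v: "has_weak_deriv unit_square \<alpha> u v" and \<alpha>: "fst \<alpha> + snd \<alpha> \<le> 1" for \<alpha> v
  proof (rule tendsto_sandwich[OF _ _ tendsto_const lim], intro always_eventually allI L2_norm_nonneg,
      intro always_eventually allI)
    fix k
    have "has_weak_deriv unit_square \<alpha> (\<psi> k) (classical_deriv \<alpha> (\<psi> k))"
    proof -
      have "\<alpha> = (0, 0) \<or> \<alpha> = (1, 0) \<or> \<alpha> = (0, 1)"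
        using \<alpha> by (cases \<alpha>) auto
      then show ?thesis
        using C_1_has_weak_deriv[OF test_functions_C_k[OF test]] has_weak_deriv_0[OF test_functions_L2[OF test]]
        by (auto simp: classical_deriv_simps)
    qed
    then show "L2_norm unit_square (\<lambda>p. v p - classical_deriv \<alpha> (\<psi> k) p)
        \<le> sobolev_norm 1 unit_square (\<lambda>p. u p - \<psi> k p)"
      by (intro L2_norm_le_sobolev_norm[OF has_weak_deriv_diff[OF v] \<alpha>])
  qed
  then show ?thesis using test by (intro exI[of _ \<psi>] conjI allI impI)
qed

lemma H10_green:
  assumes "u \<in> H10 unit_square" and v: "has_weak_deriv unit_square (1, 0) u v1" "has_weak_deriv unit_square (0, 1) u v2"
  shows "green u v1 v2"
proof -
  note L2 = v[THEN has_weak_deriv_L2(1)] v[THEN has_weak_deriv_L2(2)]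
  from H10_approx[OF assms(1)] obtain \<psi> where
    \<psi>: "(\<forall>k :: nat. \<psi> k \<in> test_functions unit_square) \<and>
      (\<forall>\<alpha> v. has_weak_deriv unit_square \<alpha> u v \<longrightarrow> fst \<alpha> + snd \<alpha> \<le> 1 \<longrightarrow>
       (\<lambda>k. L2_norm unit_square (\<lambda>p. v p - classical_deriv \<alpha> (\<psi> k) p)) \<longlonglongrightarrow> 0)"
    by (rule exE)
  have test: "\<psi> k \<in> test_functions unit_square" for k
    using \<psi> by simp
  have lim: "(\<lambda>k. L2_norm unit_square (\<lambda>p. v p - classical_deriv \<alpha> (\<psi> k) p)) \<longlonglongrightarrow> 0"
    if "has_weak_deriv unit_square \<alpha> u v" "fst \<alpha> + snd \<alpha> \<le> 1" for \<alpha> v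
    using \<psi> that by blast
  show ?thesis
  proof (rule green_weak_limit[OF L2(1,3,4) test])
    fix g assume g: "g \<in> L2 unit_square"
    show "(\<lambda>k. L2_inner unit_square g (\<psi> k)) \<longlonglongrightarrow> L2_inner unit_square g u"
      using lim[OF has_weak_deriv_0[OF L2(1)]]
      by (intro L2_inner_tendsto g L2 test_functions_L2[OF test]) (simp add: classical_deriv_simps)
    show "(\<lambda>k. L2_inner unit_square g (partial (1, 0) (\<psi> k))) \<longlonglongrightarrow> L2_inner unit_square g v1"
      using lim[OF v(1)]
      by (intro L2_inner_tendsto g L2 test_functions_L2[OF test_functions_partial[OF test]] plane_Basis)
        (simp add: classical_deriv_simps)
    show "(\<lambda>k. L2_inner unit_square g (partial (0, 1) (\<psi> k))) \<longlonglongrightarrow> L2_inner unit_square g v2"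
      using lim[OF v(2)]
      by (intro L2_inner_tendsto g L2 test_functions_L2[OF test_functions_partial[OF test]] plane_Basis)
        (simp add: classical_deriv_simps)
  qed
qed

section \<open>Sine modes\<close>

lemma smooth_upto_sin: "smooth_upto k (\<lambda>x. sin (c * x))"
  using smooth_upto_affine[of k sin c 0] smooth_upto_sin_cos by simp

lemma sin_mode_C_k: "C_k k (sin_mode m n)"
  using C_k_tensor[OF smooth_upto_sin[of k "real m * pi"] smooth_upto_sin[of k "real n * pi"]]
  by (simp add: sin_mode_def[abs_def])

lemma sin_mode_L2: "sin_mode m n \<in> L2 unit_square"
  using sin_mode_C_k[of 0 m n] by (intro continuous_L2) simp

lemma sin_has_derivative: "((\<lambda>x. sin (c * x)) has_real_derivative c * cos (c * x)) (at x)"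
  by (auto intro!: derivative_eq_intros)

text \<open>Linear vanishing at both endpoints; the right one follows from the left one by
  reflection, since \<open>sin (m * pi) = 0\<close> and \<open>cos (m * pi)\<close> has modulus 1.
  The form \<open>x - 0\<close> fits \<open>bump_deriv_bound\<close> with
  \<open>l = 0\<close>.\<close>

lemma abs_sin_mode_le:
  assumes "0 < x" "x < 1"
  shows "\<bar>sin (real m * pi * x)\<bar> \<le> real m * pi * (x - 0)" "\<bar>sin (real m * pi * x)\<bar> \<le> real m * pi * (1 - x)"
proof -
  have le: "\<bar>sin (real m * pi * y)\<bar> \<le> real m * pi * y" if "0 < y" for y
    using abs_sin_x_le_abs_x[of "real m * pi * y"] that by simp
  from le[of x] assms show "\<bar>sin (real m * pi * x)\<bar> \<le> real m * pi * (x - 0)" by simp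
  have "sin (real m * pi * x) = sin (real m * pi - real m * pi * (1 - x))"
    by (simp add: algebra_simps)
  then have "\<bar>sin (real m * pi * x)\<bar> = \<bar>sin (real m * pi * (1 - x))\<bar>"
    by (simp only: sin_diff) (simp add: abs_mult)
  with le[of "1 - x"] assms show "\<bar>sin (real m * pi * x)\<bar> \<le> real m * pi * (1 - x)" by simp
qed

section \<open>Cutoffs of the sine modes\<close>

definition sin_cut :: "nat \<Rightarrow> nat \<Rightarrow> real \<Rightarrow> real" where
  "sin_cut m k x = sin (real m * pi * x) * bump 0 1 k x"

definition sin_cut_deriv :: "nat \<Rightarrow> nat \<Rightarrow> real \<Rightarrow> real" where
  "sin_cut_deriv m k x = real m * pi * cos (real m * pi * x) * bump 0 1 k x +
     sin (real m * pi * x) * bump_deriv 0 1 k x"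

lemma sin_cut_has_derivative: "(sin_cut m k has_real_derivative sin_cut_deriv m k x) (at x)"
  unfolding sin_cut_def[abs_def] sin_cut_deriv_def
  by (rule DERIV_cong[OF DERIV_mult[OF sin_has_derivative bump_has_derivative]]) (simp add: mult_ac)

lemma smooth_upto_sin_cut: "smooth_upto j (sin_cut m k)"
  unfolding sin_cut_def[abs_def] by (intro smooth_upto_mult smooth_upto_sin smooth_upto_bump)

lemma abs_sin_cut_le: "\<bar>sin_cut m k x\<bar> \<le> 1"
  by (auto simp: sin_cut_def abs_mult abs_bump_le intro!: mult_le_one)

text \<open>The bound is uniform in \<open>k\<close>: 1 comes from differentiating the sine and 6
  from differentiating the cutoff.\<close>

lemma abs_sin_cut_deriv_le:
  assumes "0 < x" "x < 1"
  shows "\<bar>sin_cut_deriv m k x\<bar> \<le> 7 * (real m * pi)"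
proof -
  have "\<bar>real m * pi * cos (real m * pi * x) * bump 0 1 k x\<bar> \<le> real m * pi * 1 * 1"
    unfolding abs_mult by (intro mult_mono) (auto simp: abs_bump_le abs_mult)
  moreover have "\<bar>sin (real m * pi * x) * bump_deriv 0 1 k x\<bar> \<le> 6 * (real m * pi)"
    using assms abs_sin_mode_le[OF assms] by (intro bump_deriv_bound) auto
  ultimately show ?thesis unfolding sin_cut_deriv_def by linarith
qed

lemma sin_cut_tendsto:
  assumes "0 < x" "x < 1"
  shows "(\<lambda>k. sin_cut m k x) \<longlonglongrightarrow> sin (real m * pi * x)"
    "(\<lambda>k. sin_cut_deriv m k x) \<longlonglongrightarrow> real m * pi * cos (real m * pi * x)"
proof -
  have b: "(\<lambda>k. bump 0 1 k x) \<longlonglongrightarrow> 1"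
    using bump_tendsto[of 0 1 x] assms by simp
  show "(\<lambda>k. sin_cut m k x) \<longlonglongrightarrow> sin (real m * pi * x)"
    unfolding sin_cut_def using tendsto_mult[OF tendsto_const b] by simp
  show "(\<lambda>k. sin_cut_deriv m k x) \<longlonglongrightarrow> real m * pi * cos (real m * pi * x)"
    unfolding sin_cut_deriv_def
    using tendsto_add[OF tendsto_mult[OF tendsto_const b] tendsto_mult[OF tendsto_const bump_deriv_tendsto[OF assms]]]
    by simp
qed

text \<open>The cut-off modes are test functions. They and their partial derivatives are bounded
  uniformly in \<open>k\<close> and converge pointwise in the open square, so the boundary layer
  leaves no trace in the limit.\<close>

lemma sin_mode_green: "green (sin_mode m n) (partial (1, 0) (sin_mode m n)) (partial (0, 1) (sin_mode m n))"
proof -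
  define \<psi> where "\<psi> k p = sin_cut m k (fst p) * sin_cut n k (snd p)" for k and p :: plane
  have test: "\<psi> k \<in> test_functions unit_square" for k
    unfolding \<psi>_def[abs_def]
  proof (rule tensor_test_function[where d = "1 / real (Suc k)"])
    show "1 / real (Suc k) \<le> x \<and> x \<le> 1 - 1 / real (Suc k)" if "sin_cut j k x \<noteq> 0" for j x
      using bump_nonzero[of 0 1 k x] that by (auto simp: sin_cut_def)
    then show "1 / real (Suc k) \<le> x \<and> x \<le> 1 - 1 / real (Suc k)" if "sin_cut n k x \<noteq> 0" for x
      using that by blast
  qed (simp_all add: smooth_upto_sin_cut)
  have \<psi>1: "partial (1, 0) (\<psi> k) = (\<lambda>p. sin_cut_deriv m k (fst p) * sin_cut n k (snd p))"
    and \<psi>2: "partial (0, 1) (\<psi> k) = (\<lambda>p. sin_cut m k (fst p) * sin_cut_deriv n k (snd p))" for k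
    unfolding \<psi>_def[abs_def] by (rule partial_tensor[OF sin_cut_has_derivative sin_cut_has_derivative])+
  have s: "sin_mode m n = (\<lambda>p. sin (real m * pi * fst p) * sin (real n * pi * snd p))"
    by (simp add: sin_mode_def[abs_def])
  have s1: "partial (1, 0) (sin_mode m n) = (\<lambda>p. real m * pi * cos (real m * pi * fst p) * sin (real n * pi * snd p))"
    and s2: "partial (0, 1) (sin_mode m n) = (\<lambda>p. sin (real m * pi * fst p) * (real n * pi * cos (real n * pi * snd p)))"
    unfolding s by (rule partial_tensor[OF sin_has_derivative sin_has_derivative])+
  have L2: "partial v (sin_mode m n) \<in> L2 unit_square" "partial v (\<psi> k) \<in> L2 unit_square"
    if "v \<in> Basis" for v k
    by (intro continuous_L2 C_1_partial_continuous sin_mode_C_k test_functions_C_k[OF test] that)+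
  show ?thesis
  proof (rule green_weak_limit[where \<psi> = \<psi>])
    show "sin_mode m n \<in> L2 unit_square" "partial (1, 0) (sin_mode m n) \<in> L2 unit_square"
      "partial (0, 1) (sin_mode m n) \<in> L2 unit_square" "\<psi> k \<in> test_functions unit_square" for k
      by (intro sin_mode_L2 L2 plane_Basis test)+
    fix g assume g: "g \<in> L2 unit_square"
    show "(\<lambda>k. L2_inner unit_square g (\<psi> k)) \<longlonglongrightarrow> L2_inner unit_square g (sin_mode m n)"
      by (rule L2_inner_dominated[where B = "1 * 1", OF g test_functions_L2[OF test] sin_mode_L2])
        (auto simp: s \<psi>_def mem_unit_square abs_mult intro!: tendsto_mult sin_cut_tendsto
          mult_le_one abs_sin_cut_le)
    have lim: "(\<lambda>k. partial (1, 0) (\<psi> k) p) \<longlonglongrightarrow> partial (1, 0) (sin_mode m n) p"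
      "(\<lambda>k. partial (0, 1) (\<psi> k) p) \<longlonglongrightarrow> partial (0, 1) (sin_mode m n) p"
      if "p \<in> unit_square" for p
      using that unfolding s1 s2 \<psi>1 \<psi>2 mem_unit_square by (auto intro!: tendsto_mult sin_cut_tendsto)
    have bound: "\<bar>partial (1, 0) (\<psi> k) p\<bar> \<le> 7 * (real m * pi) * 1"
      "\<bar>partial (0, 1) (\<psi> k) p\<bar> \<le> 1 * (7 * (real n * pi))"
      if "p \<in> unit_square" for p k
      using that unfolding \<psi>1 \<psi>2 mem_unit_square abs_mult
      by (intro mult_mono abs_sin_cut_deriv_le abs_sin_cut_le; simp)+
    show "(\<lambda>k. L2_inner unit_square g (partial (1, 0) (\<psi> k))) \<longlonglongrightarrow> L2_inner unit_square g (partial (1, 0) (sin_mode m n))"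
      by (rule L2_inner_dominated[OF g _ _ lim(1) bound(1)]) (intro L2 plane_Basis)+
    show "(\<lambda>k. L2_inner unit_square g (partial (0, 1) (\<psi> k))) \<longlonglongrightarrow> L2_inner unit_square g (partial (0, 1) (sin_mode m n))"
      by (rule L2_inner_dominated[OF g _ _ lim(2) bound(2)]) (intro L2 plane_Basis)+
  qed
qed

section \<open>Completeness of the sine system\<close>

inductive_set sine_span :: "(plane \<Rightarrow> real) set" where
  mode: "sin_mode m n \<in> sine_span"
| add: "f \<in> sine_span \<Longrightarrow> g \<in> sine_span \<Longrightarrow> (\<lambda>p. f p + g p) \<in> sine_span"
| cmult: "f \<in> sine_span \<Longrightarrow> (\<lambda>p. c * f p) \<in> sine_span"

lemma sine_span_continuous: "f \<in> sine_span \<Longrightarrow> continuous_on A f"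
  by (induction rule: sine_span.induct) (auto simp: sin_mode_def[abs_def] intro!: continuous_intros)

lemma sine_span_L2: "f \<in> sine_span \<Longrightarrow> f \<in> L2 unit_square"
  by (intro continuous_L2 sine_span_continuous)

lemma cos_times_sin_mode:
  "cos (pi * x) * sin (real (Suc m) * pi * x) =
     1/2 * sin (real (Suc (Suc m)) * pi * x) + 1/2 * sin (real m * pi * x)"
proof -
  have "real (Suc (Suc m)) * pi * x = real (Suc m) * pi * x + pi * x"
    "real m * pi * x = real (Suc m) * pi * x - pi * x"
    by (simp_all add: algebra_simps)
  then show ?thesis
    by (simp only: sin_add sin_diff) (simp add: algebra_simps)
qed

text \<open>By the product-to-sum formula, multiplication by a cosine of frequency 1 replaces a mode
  by the mean of its two neighbours in that index.\<close>

lemma sine_span_mult_cos: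
  assumes "f \<in> sine_span"
  shows "(\<lambda>p. cos (pi * fst p) * f p) \<in> sine_span" "(\<lambda>p. cos (pi * snd p) * f p) \<in> sine_span"
proof -
  have *: "(\<lambda>p. 1/2 * sin_mode m n p + 1/2 * sin_mode k l p) \<in> sine_span" for m n k l
    by (intro sine_span.intros)
  have zero: "(\<lambda>p. 0) \<in> sine_span"
    using sine_span.cmult[OF sine_span.mode, of 0] by simp
  show "(\<lambda>p. cos (pi * fst p) * f p) \<in> sine_span"
    using assms
  proof induction
    case (mode m n)
    show ?case
    proof (cases m)
      case 0
      then show ?thesis using zero by (simp add: sin_mode_def)
    next
      case (Suc k)
      have "cos (pi * fst p) * sin_mode m n p = 1/2 * sin_mode (Suc (Suc k)) n p + 1/2 * sin_mode k n p" for p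
        unfolding Suc sin_mode_def mult.assoc[symmetric, of "cos (pi * fst p)"] cos_times_sin_mode
        by (simp only: distrib_right mult.assoc)
      then show ?thesis using * by simp
    qed
  next
    case (add f g)
    then show ?case using sine_span.add[OF add.IH] by (simp add: distrib_left)
  next
    case (cmult f c)
    then show ?case using sine_span.cmult[OF cmult.IH, of c] by (simp add: mult.left_commute)
  qed
  show "(\<lambda>p. cos (pi * snd p) * f p) \<in> sine_span"
    using assms
  proof induction
    case (mode m n)
    show ?case
    proof (cases n)
      case 0
      then show ?thesis using zero by (simp add: sin_mode_def)
    next
      case (Suc k)
      have "cos (pi * snd p) * sin_mode m n p = 1/2 * sin_mode m (Suc (Suc k)) p + 1/2 * sin_mode m k p" for p
        unfolding Suc sin_mode_def mult.left_commute[of "cos (pi * snd p)"] cos_times_sin_mode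
        by (simp only: distrib_left mult.left_commute)
      then show ?thesis using * by simp
    qed
  next
    case (add f g)
    then show ?case using sine_span.add[OF add.IH] by (simp add: distrib_left)
  next
    case (cmult f c)
    then show ?case using sine_span.cmult[OF cmult.IH, of c] by (simp add: mult.left_commute)
  qed
qed

text \<open>By Stone-Weierstrass the multipliers of the sine span, which include the cosines, approximate the
  quotient of a test function by the first sine mode; multiplying back gives an approximation of the test
  function by sine modes.\<close>

lemma test_function_approx_sine_span:
  assumes \<psi>: "\<psi> \<in> test_functions unit_square" and e: "0 < e"
  obtains s where "s \<in> sine_span" "\<And>p. p \<in> unit_square \<Longrightarrow> \<bar>\<psi> p - s p\<bar> \<le> e"
proof -
  \<comment> \<open>All elements of the sine span vanish on the boundary, so the span contains no
    nonzero constants and Stone-Weierstrass does not apply to it; the ring \<open>R\<close> of its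
    continuous multipliers does contain them.\<close>
  define R where "R = {f. continuous_on UNIV f \<and> (\<forall>s\<in>sine_span. (\<lambda>p. f p * s p) \<in> sine_span)}"
  let ?Q = "cbox (0, 0) (1, 1) :: plane set"
  have cos_R: "(\<lambda>p. cos (pi * fst p)) \<in> R" "(\<lambda>p. cos (pi * snd p)) \<in> R"
    by (auto simp: R_def sine_span_mult_cos intro!: continuous_intros)
  have "function_ring_on R ?Q"
  proof
    show "(\<lambda>_. c) \<in> R" for c
      by (simp add: R_def sine_span.cmult)
    show "(\<lambda>x. f x + g x) \<in> R" if "f \<in> R" "g \<in> R" for f g
      using that by (auto simp: R_def distrib_right intro!: continuous_intros sine_span.add)
    show "(\<lambda>x. f x * g x) \<in> R" if "f \<in> R" "g \<in> R" for f g
      using that by (auto simp: R_def mult.assoc intro!: continuous_intros)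
    show "continuous_on ?Q f" if "f \<in> R" for f
      using that by (auto simp: R_def intro: continuous_on_subset)
    show "\<exists>f\<in>R. f p \<noteq> f q" if "p \<in> ?Q" "q \<in> ?Q" "p \<noteq> q" for p q
    proof -
      have range: "0 \<le> fst p" "fst p \<le> 1" "0 \<le> fst q" "fst q \<le> 1"
        "0 \<le> snd p" "snd p \<le> 1" "0 \<le> snd q" "snd q \<le> 1"
        using that by (cases p; cases q; auto simp: mem_box Basis_prod_def)+
      \<comment> \<open>\<open>cos (pi * x)\<close> is injective on the unit interval, so the two
        cosines separate the points of the closed square.\<close>
      have inj: "x = y" if "cos (pi * x) = cos (pi * y)" "0 \<le> x" "x \<le> 1" "0 \<le> y" "y \<le> 1" for x y
        using cos_inj_pi[of "pi * x" "pi * y"] that by simp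
      from \<open>p \<noteq> q\<close> have "fst p \<noteq> fst q \<or> snd p \<noteq> snd q"
        by (simp add: prod_eq_iff)
      then show ?thesis
      proof
        assume "fst p \<noteq> fst q"
        then show ?thesis using inj[of "fst p" "fst q"] range by (intro bexI[OF _ cos_R(1)]) blast
      next
        assume "snd p \<noteq> snd q"
        then show ?thesis using inj[of "snd p" "snd q"] range by (intro bexI[OF _ cos_R(2)]) blast
      qed
    qed
  qed simp
  then interpret function_ring_on R ?Q .
  define K where "K = closure {p. \<psi> p \<noteq> 0}"
  have K: "closed K" "K \<subseteq> unit_square"
    using \<psi> by (auto simp: test_functions_def K_def)
  have zero: "\<psi> p = 0" if "p \<notin> K" for p
    using that closure_subset[of "{p. \<psi> p \<noteq> 0}"] by (auto simp: K_def)
  have pos: "0 < sin_mode 1 1 p" if "p \<in> unit_square" for p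
    using that by (auto simp: sin_mode_def mem_unit_square intro!: mult_pos_pos sin_gt_zero)
  define h where "h p = \<psi> p / sin_mode 1 1 p" for p
  \<comment> \<open>Two open sets cover the closed square: the open square, where the denominator is
    positive, and the complement of \<open>K\<close>, where \<open>h\<close> is 0 even at edge
    points with vanishing denominator.\<close>
  have "continuous_on (unit_square \<union> - K) h"
  proof (rule continuous_on_open_Un)
    have "continuous_on UNIV \<psi>"
      using test_functions_C_k[OF \<psi>, of 0] by simp
    then have "continuous_on unit_square \<psi>"
      using continuous_on_subset by blast
    moreover have "sin_mode 1 1 p \<noteq> 0" if "p \<in> unit_square" for p
      using pos[OF that] by simp
    ultimately show "continuous_on unit_square h"
      unfolding h_def by (intro continuous_on_divide sine_span_continuous[OF sine_span.mode]) auto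
    have "continuous_on (- K) (\<lambda>p. 0 :: real)" by simp
    then show "continuous_on (- K) h"
      by (rule continuous_on_eq) (simp add: h_def zero)
  qed (use K open_unit_square in auto)
  then have "continuous_on ?Q h"
    by (rule continuous_on_subset) (use K in auto)
  then obtain g where g: "g \<in> R" "\<And>p. p \<in> ?Q \<Longrightarrow> \<bar>h p - g p\<bar> < e"
    using Stone_Weierstrass_basic e by blast
  show ?thesis
  proof
    show "(\<lambda>p. g p * sin_mode 1 1 p) \<in> sine_span"
      using g(1) by (simp add: R_def sine_span.mode)
    fix p assume p: "p \<in> unit_square"
    have "\<psi> p - g p * sin_mode 1 1 p = (h p - g p) * sin_mode 1 1 p"
      using pos[OF p] by (simp add: h_def field_simps)
    moreover have "\<bar>h p - g p\<bar> \<le> e"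
      using g(2)[of p] p box_subset_cbox[of "(0, 0)" "(1, 1) :: plane"] by (force simp: unit_square_eq_box)
    moreover have "\<bar>sin_mode 1 1 p\<bar> \<le> 1"
      by (auto simp: sin_mode_def abs_mult intro!: mult_le_one)
    ultimately show "\<bar>\<psi> p - g p * sin_mode 1 1 p\<bar> \<le> e"
      using mult_mono[of "\<bar>h p - g p\<bar>" e "\<bar>sin_mode 1 1 p\<bar>" 1] e by (simp add: abs_mult)
  qed
qed

section \<open>Finite projectors and Bessel's inequality\<close>

text \<open>Besides indexing the projector sum, membership in some \<open>modes N\<close> serves as
  the hypothesis that both indices are at least 1.\<close>

definition modes :: "nat \<Rightarrow> (nat \<times> nat) set" where
  "modes N = {1..N} \<times> {1..N}"

abbreviation eigen :: "nat \<times> nat \<Rightarrow> plane \<Rightarrow> real" where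
  "eigen i \<equiv> eigenfun (fst i) (snd i)"

abbreviation coeff :: "(plane \<Rightarrow> real) \<Rightarrow> nat \<times> nat \<Rightarrow> real" where
  "coeff u i \<equiv> eigen_coeff u (fst i) (snd i)"

lemma finite_modes: "finite (modes N)"
  by (simp add: modes_def)

lemma spectral_proj_eq: "spectral_proj N u p = (\<Sum>i\<in>modes N. coeff u i * eigen i p)"
  by (simp add: spectral_proj_def modes_def sum.cartesian_product case_prod_unfold)

lemma eigenfun_eq_sin_mode:
  assumes "i \<in> modes N"
  shows "eigen i = (\<lambda>p. 2 * sin_mode (fst i) (snd i) p)"
  using assms by (auto simp: eigenfun_eq modes_def sin_mode_def mult.assoc)

lemma eigen_L2: "i \<in> modes N \<Longrightarrow> eigen i \<in> L2 unit_square"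
  by (simp add: eigenfun_eq_sin_mode L2_cmult sin_mode_L2)

lemma spectral_proj_L2: "spectral_proj N u \<in> L2 unit_square"
  unfolding spectral_proj_eq[abs_def] by (intro L2_sum L2_cmult eigen_L2)

lemma inner_eigen: "i \<in> modes M \<Longrightarrow> j \<in> modes N \<Longrightarrow>
    L2_inner unit_square (eigen i) (eigen j) = (if i = j then 1 else 0)"
  using eigenfun_orthonormal[of "fst i" "snd i" "fst j" "snd j"] by (auto simp: modes_def prod_eq_iff)

lemma inner_spectral_proj:
  assumes "h \<in> L2 unit_square"
  shows "L2_inner unit_square h (spectral_proj N u) = (\<Sum>i\<in>modes N. coeff u i * coeff h i)"
  unfolding spectral_proj_eq[abs_def]
  by (simp add: L2_inner_sum_right L2_inner_cmult_right assms eigen_L2 L2_cmult eigen_coeff_def)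

lemma coeff_spectral_proj:
  assumes j: "j \<in> modes N"
  shows "coeff (spectral_proj M u) j = (if j \<in> modes M then coeff u j else 0)"
proof -
  have "coeff (spectral_proj M u) j = L2_inner unit_square (spectral_proj M u) (eigen j)"
    by (simp add: eigen_coeff_def)
  also have "\<dots> = (\<Sum>i\<in>modes M. coeff u i * L2_inner unit_square (eigen i) (eigen j))"
    unfolding spectral_proj_eq[abs_def]
    by (simp add: L2_inner_sum_left L2_inner_cmult_left eigen_L2[OF j] eigen_L2 L2_cmult)
  also have "\<dots> = (\<Sum>i\<in>modes M. if i = j then coeff u j else 0)"
    using j by (intro sum.cong) (auto simp: inner_eigen)
  finally show ?thesis
    using finite_modes by simp
qed

text \<open>The projector is symmetric: both sides subtract the same sum of products of
  coefficients. The residual moves onto the fixed \<open>h\<close>, whose residuals have norm at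
  most that of \<open>h\<close>, and \<open>u\<close> is free to be approximated.\<close>

lemma inner_residual_commute:
  assumes "h \<in> L2 unit_square" "u \<in> L2 unit_square"
  shows "L2_inner unit_square h (\<lambda>p. u p - spectral_proj N u p) =
    L2_inner unit_square (\<lambda>p. h p - spectral_proj N h p) u"
  using assms
  by (simp add: L2_inner_diff_right L2_inner_diff_left spectral_proj_L2 inner_spectral_proj
      L2_inner_commute[of _ "spectral_proj N h"] mult.commute)

text \<open>Pythagoras for the orthonormal modes; nonnegativity of the left side gives Bessel's
  inequality.\<close>

lemma residual_inner_self:
  assumes "h \<in> L2 unit_square"
  shows "L2_inner unit_square (\<lambda>p. h p - spectral_proj N h p) (\<lambda>p. h p - spectral_proj N h p) =
    L2_inner unit_square h h - (\<Sum>i\<in>modes N. (coeff h i)\<^sup>2)"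
proof -
  have "L2_inner unit_square (spectral_proj N h) (spectral_proj N h) = (\<Sum>i\<in>modes N. (coeff h i)\<^sup>2)"
    by (simp add: inner_spectral_proj spectral_proj_L2 coeff_spectral_proj power2_eq_square)
  then show ?thesis
    using assms by (simp add: L2_inner_diff_right L2_inner_diff_left L2_diff spectral_proj_L2
        inner_spectral_proj L2_inner_commute[of _ "spectral_proj N h" h] power2_eq_square)
qed

lemma Bessel: "h \<in> L2 unit_square \<Longrightarrow> (\<Sum>i\<in>modes N. (coeff h i)\<^sup>2) \<le> (L2_norm unit_square h)\<^sup>2"
  using residual_inner_self[of h N] L2_inner_self_nonneg[of unit_square "\<lambda>p. h p - spectral_proj N h p"]
  by (simp add: L2_norm_power2)

lemma residual_norm_le:
  assumes "h \<in> L2 unit_square"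
  shows "L2_norm unit_square (\<lambda>p. h p - spectral_proj N h p) \<le> L2_norm unit_square h"
proof (rule power2_le_imp_le)
  show "(L2_norm unit_square (\<lambda>p. h p - spectral_proj N h p))\<^sup>2 \<le> (L2_norm unit_square h)\<^sup>2"
    unfolding L2_norm_power2 residual_inner_self[OF assms] by (simp add: sum_nonneg)
qed (rule L2_norm_nonneg)

text \<open>An element of the span involves finitely many modes, and the residual is orthogonal to
  all of them once the cutoff exceeds their indices.\<close>

lemma residual_orthogonal_sine_span:
  assumes h: "h \<in> L2 unit_square" and "s \<in> sine_span"
  shows "\<exists>K. \<forall>N\<ge>K. L2_inner unit_square (\<lambda>p. h p - spectral_proj N h p) s = 0"
  using assms(2)
proof induction
  case (mode m n)
  show ?case
  proof (cases "m = 0 \<or> n = 0")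
    case True
    then have "sin_mode m n = (\<lambda>p. 0)" by (auto simp: sin_mode_def)
    then show ?thesis by (simp add: L2_inner_zero)
  next
    case False
    have "L2_inner unit_square (\<lambda>p. h p - spectral_proj N h p) (sin_mode m n) = 0" if "max m n \<le> N" for N
    proof -
      have i: "(m, n) \<in> modes N" using False that by (simp add: modes_def)
      have "L2_inner unit_square (\<lambda>p. h p - spectral_proj N h p) (eigen (m, n)) = 0"
        using coeff_spectral_proj[OF i, of N h] h eigen_L2[OF i] i
        by (simp add: L2_inner_diff_left spectral_proj_L2 eigen_coeff_def)
      then show ?thesis
        by (simp add: eigenfun_eq_sin_mode[OF i, simplified] L2_inner_cmult_right)
    qed
    then show ?thesis by blast
  qed
next
  case (add f g)
  then obtain K L where "\<forall>N\<ge>K. L2_inner unit_square (\<lambda>p. h p - spectral_proj N h p) f = 0"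
    "\<forall>N\<ge>L. L2_inner unit_square (\<lambda>p. h p - spectral_proj N h p) g = 0" by blast
  then show ?case
    using add.hyps h
    by (intro exI[of _ "max K L"]) (simp add: L2_inner_add_right sine_span_L2 L2_diff spectral_proj_L2)
next
  case (cmult f c)
  then show ?case by (simp add: L2_inner_cmult_right) blast
qed

lemma L2_norm_le:
  assumes "f \<in> L2 unit_square" "\<And>p. p \<in> unit_square \<Longrightarrow> \<bar>f p\<bar> \<le> e" "0 \<le> e"
  shows "L2_norm unit_square f \<le> e"
proof -
  have "measure lsq unit_square = 1"
    by (simp add: measure_restrict_space unit_square_eq_box measure_lborel_box_eq
        Basis_prod_def)
  then have "(LINT p|lsq. e\<^sup>2) = e\<^sup>2"
    by (simp add: space_lsq)
  moreover have "(LINT p|lsq. (f p)\<^sup>2) \<le> (LINT p|lsq. e\<^sup>2)"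
    using assms finite_measure.integrable_const[OF finite_measure_lsq]
    by (intro integral_mono) (auto simp: L2_def space_lsq abs_le_square_iff[symmetric])
  ultimately show ?thesis
    unfolding L2_norm_def by (intro real_le_lsqrt assms(3)) linarith
qed

section \<open>Weak convergence of the projections\<close>

text \<open>\<open>u\<close> is approximated by a test function in norm, and that by a sine sum
  uniformly; the residual of \<open>h\<close> is eventually orthogonal to the sine sum, and
  Cauchy-Schwarz controls the two approximation errors.\<close>

lemma residual_weak_limit:
  assumes u: "u \<in> H10 unit_square" "u \<in> L2 unit_square" and h: "h \<in> L2 unit_square"
  shows "(\<lambda>N. L2_inner unit_square h (\<lambda>p. u p - spectral_proj N u p)) \<longlonglongrightarrow> 0"
proof (rule LIMSEQ_I)
  fix e :: real assume "0 < e"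
  define B where "B = L2_norm unit_square h"
  \<comment> \<open>Chosen so that the two errors of size \<open>B * d\<close> add up to
    \<open>e - 2 * d\<close>; the 1 in the denominator covers \<open>B = 0\<close>.\<close>
  define d where "d = e / 2 / (B + 1)"
  have B: "0 \<le> B" by (simp add: B_def L2_norm_nonneg)
  then have d: "0 < d" using \<open>0 < e\<close> by (simp add: d_def)
  obtain \<psi> where test: "\<And>k. \<psi> k \<in> test_functions unit_square"
    and "(\<lambda>k. L2_norm unit_square (\<lambda>p. u p - \<psi> k p)) \<longlonglongrightarrow> 0"
    using H10_approx[OF u(1)] has_weak_deriv_0[OF u(2)] by (force simp: classical_deriv_simps)
  then obtain k where k: "L2_norm unit_square (\<lambda>p. u p - \<psi> k p) < d"
    using d LIMSEQ_D[of _ 0 d] L2_norm_nonneg by fastforce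
  obtain s where s: "s \<in> sine_span" "\<And>p. p \<in> unit_square \<Longrightarrow> \<bar>\<psi> k p - s p\<bar> \<le> d"
    using test_function_approx_sine_span[OF test d] by blast
  note L2 = u(2) h test_functions_L2[OF test[of k]] sine_span_L2[OF s(1)] spectral_proj_L2
  have k': "L2_norm unit_square (\<lambda>p. \<psi> k p - s p) \<le> d"
    using d by (intro L2_norm_le s L2_diff L2) auto
  obtain K where K: "\<And>N. N \<ge> K \<Longrightarrow> L2_inner unit_square (\<lambda>p. h p - spectral_proj N h p) s = 0"
    using residual_orthogonal_sine_span[OF h s(1)] by blast
  have "\<bar>L2_inner unit_square h (\<lambda>p. u p - spectral_proj N u p)\<bar> < e" if "N \<ge> K" for N
  proof -
    let ?r = "\<lambda>p. h p - spectral_proj N h p"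
    have r: "?r \<in> L2 unit_square" by (intro L2_diff L2)
    have bound: "\<bar>L2_inner unit_square ?r f\<bar> \<le> B * d"
      if "f \<in> L2 unit_square" "L2_norm unit_square f \<le> d" for f
      using L2_Cauchy_Schwarz[OF r that(1)] mult_mono[OF residual_norm_le[OF h, of N] that(2)] B
        L2_norm_nonneg[of unit_square f] by (simp add: B_def)
    have "L2_inner unit_square h (\<lambda>p. u p - spectral_proj N u p) = L2_inner unit_square ?r u"
      by (rule inner_residual_commute[OF h u(2)])
    also have "\<dots> = L2_inner unit_square ?r (\<lambda>p. u p - \<psi> k p) +
        L2_inner unit_square ?r (\<lambda>p. \<psi> k p - s p)"
      using K[OF \<open>N \<ge> K\<close>] r L2 by (simp add: L2_inner_diff_right)
    also have "\<bar>\<dots>\<bar> \<le> B * d + B * d"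
      using k k' L2 by (intro order_trans[OF abs_triangle_ineq] add_mono bound L2_diff) auto
    also have "B * d + B * d = e - 2 * d"
    proof -
      have "B + 1 \<noteq> 0" using B by simp
      then have "d * (B + 1) = e / 2"
        using d_def by (rule nonzero_eq_divide_eq[THEN iffD1])
      then show ?thesis by (simp add: algebra_simps)
    qed
    also have "\<dots> < e" using d by simp
    finally show ?thesis .
  qed
  then show "\<exists>K. \<forall>N\<ge>K. norm (L2_inner unit_square h (\<lambda>p. u p - spectral_proj N u p) - 0) < e"
    by auto
qed

section \<open>The energy of the projection error\<close>

lemma partial_cmult:
  assumes "C_k 1 f"
  shows "partial v (\<lambda>p. c * f p) p =
    c * (fst v * partial (1, 0) f p + snd v * partial (0, 1) f p)"
  by (simp add: partial_eq[OF has_derivative_mult_right[OF C_1_has_derivative[OF assms]]])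

lemma eigen_C_k:
  assumes "i \<in> modes N"
  shows "C_k k (eigen i)"
proof -
  have "C_k k (\<lambda>p. (2 * sin (real (fst i) * pi * fst p)) * sin (real (snd i) * pi * snd p))"
    by (rule C_k_tensor[OF smooth_upto_mult[OF smooth_upto_const smooth_upto_sin] smooth_upto_sin])
  then show ?thesis
    using assms by (simp add: eigenfun_eq_sin_mode sin_mode_def mult.assoc)
qed

lemma eigen_green:
  assumes "i \<in> modes N"
  shows "green (eigen i) (partial (1, 0) (eigen i)) (partial (0, 1) (eigen i))"
  using green_cmult[OF sin_mode_green, of 2 "fst i" "snd i"]
  by (simp add: eigenfun_eq_sin_mode[OF assms] partial_cmult[OF sin_mode_C_k, abs_def])

text \<open>Integration by parts of the classical eigenvalue equation, put in the form of the
  premise of \<open>greenD\<close> with the gradient of the mode as \<open>g1\<close> and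
  \<open>g2\<close>.\<close>

lemma eigen_weak_eigenvalue:
  assumes i: "i \<in> modes N" and \<psi>: "\<psi> \<in> test_functions unit_square"
  shows "L2_inner unit_square (partial (1, 0) (eigen i)) (partial (1, 0) \<psi>) +
    L2_inner unit_square (partial (0, 1) (eigen i)) (partial (0, 1) \<psi>) =
    eigenval (fst i) (snd i) * L2_inner unit_square (eigen i) \<psi>"
proof -
  have C1: "C_k 1 (partial v (eigen i))" if "v \<in> Basis" for v
    using eigen_C_k[OF i, of "Suc 1"] that by simp
  have L2: "partial v (partial v (eigen i)) \<in> L2 unit_square" if "v \<in> Basis" for v
    by (intro continuous_L2 C_1_partial_continuous C1 that)
  have "eigenval (fst i) (snd i) * L2_inner unit_square (eigen i) \<psi> =
      L2_inner unit_square (\<lambda>p. - (partial (1, 0) (partial (1, 0) (eigen i)) p +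
        partial (0, 1) (partial (0, 1) (eigen i)) p)) \<psi>"
    unfolding L2_inner_cmult_left[symmetric] eigenfun_laplacian[symmetric] classical_deriv_simps ..
  also have "\<dots> = - L2_inner unit_square (partial (1, 0) (partial (1, 0) (eigen i))) \<psi> -
      L2_inner unit_square (partial (0, 1) (partial (0, 1) (eigen i))) \<psi>"
    using L2[OF plane_Basis(1)] L2[OF plane_Basis(2)] test_functions_L2[OF \<psi>]
    by (subst L2_inner_minus_left) (simp add: L2_inner_add_left)
  finally show ?thesis
    using L2_inner_by_parts[OF C1[OF plane_Basis(1)] \<psi> plane_Basis(1)]
      L2_inner_by_parts[OF C1[OF plane_Basis(2)] \<psi> plane_Basis(2)] by simp
qed

text \<open>Take a test function for one of \<open>g1\<close>, \<open>g2\<close>, zero for the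
  other, and minus its partial derivative for \<open>h\<close>: the premise of \<open>green\<close>
  is then integration by parts between two test functions.\<close>

lemma green_has_weak_deriv:
  assumes "green u v1 v2"
  shows "has_weak_deriv unit_square (1, 0) u v1" "has_weak_deriv unit_square (0, 1) u v2"
proof -
  have by_parts: "L2_inner unit_square \<psi> (partial v \<xi>) = L2_inner unit_square (\<lambda>p. - partial v \<psi> p) \<xi>"
    if "\<psi> \<in> test_functions unit_square" "\<xi> \<in> test_functions unit_square" "v \<in> Basis" for \<psi> \<xi> v
    using L2_inner_by_parts[OF test_functions_C_k[OF that(1)] that(2,3)] by (simp add: L2_inner_minus_left)
  have minus_L2: "(\<lambda>p. - partial v \<psi> p) \<in> L2 unit_square"
    if "\<psi> \<in> test_functions unit_square" "v \<in> Basis" for \<psi> v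
    by (intro L2_minus test_functions_L2[OF test_functions_partial[OF that]])
  show "has_weak_deriv unit_square (1, 0) u v1"
  proof (rule has_weak_derivI)
    fix \<psi> assume \<psi>: "\<psi> \<in> test_functions unit_square"
    have "L2_inner unit_square \<psi> v1 + L2_inner unit_square (\<lambda>p. 0) v2 =
        L2_inner unit_square (\<lambda>p. - partial (1, 0) \<psi> p) u"
      by (rule greenD[OF assms test_functions_L2[OF \<psi>] L2_zero minus_L2[OF \<psi> plane_Basis(1)]])
        (simp add: L2_inner_zero by_parts[OF \<psi> _ plane_Basis(1)])
    then show "L2_inner unit_square u (classical_deriv (1, 0) \<psi>) =
        (- 1) ^ (fst (1, 0) + snd (1, 0)) * L2_inner unit_square v1 \<psi>"
      by (simp add: L2_inner_zero L2_inner_minus_left classical_deriv_simps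
          L2_inner_commute[of _ u] L2_inner_commute[of _ v1])
  qed (use green_L2[OF assms] in auto)
  show "has_weak_deriv unit_square (0, 1) u v2"
  proof (rule has_weak_derivI)
    fix \<psi> assume \<psi>: "\<psi> \<in> test_functions unit_square"
    have "L2_inner unit_square (\<lambda>p. 0) v1 + L2_inner unit_square \<psi> v2 =
        L2_inner unit_square (\<lambda>p. - partial (0, 1) \<psi> p) u"
      by (rule greenD[OF assms L2_zero test_functions_L2[OF \<psi>] minus_L2[OF \<psi> plane_Basis(2)]])
        (simp add: L2_inner_zero by_parts[OF \<psi> _ plane_Basis(2)])
    then show "L2_inner unit_square u (classical_deriv (0, 1) \<psi>) =
        (- 1) ^ (fst (0, 1) + snd (0, 1)) * L2_inner unit_square v2 \<psi>"
      by (simp add: L2_inner_zero L2_inner_minus_left classical_deriv_simps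
          L2_inner_commute[of _ u] L2_inner_commute[of _ v2])
  qed (use green_L2[OF assms] in auto)
qed

lemma H10_norm_green:
  assumes "green u v1 v2"
  shows "(H10_norm unit_square u)\<^sup>2 = L2_inner unit_square v1 v1 + L2_inner unit_square v2 v2"
proof -
  let ?d1 = "weak_deriv unit_square (1, 0) u" and ?d2 = "weak_deriv unit_square (0, 1) u"
  note d = green_has_weak_deriv[OF assms]
  note L2 = has_weak_deriv_L2(2)[OF has_weak_deriv_weak_deriv[OF d(1)]]
    has_weak_deriv_L2(2)[OF has_weak_deriv_weak_deriv[OF d(2)]]
  have "(H10_norm unit_square u)\<^sup>2 = (LINT p|lsq. (?d1 p)\<^sup>2 + (?d2 p)\<^sup>2)"
    by (simp add: H10_norm_def weak_grad_def norm_Pair)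
  also have "\<dots> = (LINT p|lsq. (?d1 p)\<^sup>2) + (LINT p|lsq. (?d2 p)\<^sup>2)"
    using L2 by (intro Bochner_Integration.integral_add) (simp_all add: L2_def)
  also have "\<dots> = (L2_norm unit_square ?d1)\<^sup>2 + (L2_norm unit_square ?d2)\<^sup>2"
    by (simp add: L2_norm_def)
  finally show ?thesis
    by (simp only: L2_norm_weak_deriv[OF d(1)] L2_norm_weak_deriv[OF d(2)] L2_norm_power2)
qed

text \<open>The pairing of \<open>u\<close> with a second partial derivative of
  \<open>\<psi>\<close> is read in two ways: through the second weak derivative tested with
  \<open>\<psi>\<close>, and through the first one tested with the partial derivative of
  \<open>\<psi>\<close>.\<close>

lemma weak_laplacian:
  assumes u: "u \<in> sobolev 2 unit_square" and \<psi>: "\<psi> \<in> test_functions unit_square"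
  shows "L2_inner unit_square (weak_deriv unit_square (1, 0) u) (partial (1, 0) \<psi>) +
    L2_inner unit_square (weak_deriv unit_square (0, 1) u) (partial (0, 1) \<psi>) =
    L2_inner unit_square
      (\<lambda>p. - (weak_deriv unit_square (2, 0) u p + weak_deriv unit_square (0, 2) u p)) \<psi>"
proof -
  note w = sobolev_has_weak_deriv[OF u]
  have "L2_inner unit_square (weak_deriv unit_square (1, 0) u) (partial (1, 0) \<psi>) =
      - L2_inner unit_square (weak_deriv unit_square (2, 0) u) \<psi>"
    using has_weak_deriv_inner[OF w[of "(1, 0)"] test_functions_partial[OF \<psi> plane_Basis(1)]]
      has_weak_deriv_inner[OF w[of "(2, 0)"] \<psi>]
    by (simp add: classical_deriv_simps)
  moreover have "L2_inner unit_square (weak_deriv unit_square (0, 1) u) (partial (0, 1) \<psi>) =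
      - L2_inner unit_square (weak_deriv unit_square (0, 2) u) \<psi>"
    using has_weak_deriv_inner[OF w[of "(0, 1)"] test_functions_partial[OF \<psi> plane_Basis(2)]]
      has_weak_deriv_inner[OF w[of "(0, 2)"] \<psi>]
    by (simp add: classical_deriv_simps)
  moreover have "weak_deriv unit_square (2, 0) u \<in> L2 unit_square" "weak_deriv unit_square (0, 2) u \<in> L2 unit_square"
    using has_weak_deriv_L2(2)[OF w] by simp_all
  ultimately show ?thesis
    using test_functions_L2[OF \<psi>] by (subst L2_inner_minus_left) (simp add: L2_inner_add_left)
qed

text \<open>Expanding the square of the norm of the difference bounds the mixed term, which costs
  the factor 2.\<close>

lemma laplacian_norm_le:
  assumes u: "u \<in> sobolev 2 unit_square"
  shows "(L2_norm unit_square
      (\<lambda>p. - (weak_deriv unit_square (2, 0) u p + weak_deriv unit_square (0, 2) u p)))\<^sup>2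
    \<le> 2 * (sobolev_norm 2 unit_square u)\<^sup>2"
proof -
  let ?a = "weak_deriv unit_square (2, 0) u" and ?b = "weak_deriv unit_square (0, 2) u"
  have L2: "?a \<in> L2 unit_square" "?b \<in> L2 unit_square"
    using has_weak_deriv_L2(2)[OF sobolev_has_weak_deriv[OF u]] by simp_all
  have "0 \<le> L2_inner unit_square (\<lambda>p. ?a p - ?b p) (\<lambda>p. ?a p - ?b p)"
    by (rule L2_inner_self_nonneg)
  then have "L2_inner unit_square (\<lambda>p. - (?a p + ?b p)) (\<lambda>p. - (?a p + ?b p)) \<le>
      2 * ((L2_norm unit_square ?a)\<^sup>2 + (L2_norm unit_square ?b)\<^sup>2)"
    unfolding L2_norm_power2 L2_inner_minus_left L2_inner_minus_right
    using L2 L2_inner_commute[of unit_square ?b ?a]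
    by (simp add: L2_inner_add_left L2_inner_add_right L2_inner_diff_left L2_inner_diff_right L2_add L2_diff)
  also have "\<dots> \<le> 2 * (sobolev_norm 2 unit_square u)\<^sup>2"
    using sum_weak_deriv_le_sobolev_norm[of "{(2, 0), (0, 2)}" 2 unit_square u] by simp
  finally show ?thesis by (simp add: L2_norm_power2)
qed

lemma projection_error_energy:
  assumes u: "u \<in> sobolev 2 unit_square" "u \<in> H10 unit_square" and M: "M \<ge> 1"
  shows "(H10_norm unit_square (\<lambda>p. u p - spectral_proj M u p))\<^sup>2 \<le>
    2 * (sobolev_norm 2 unit_square u)\<^sup>2 / (pi * real M)\<^sup>2"
proof -
  define v1 where "v1 = weak_deriv unit_square (1, 0) u"
  define v2 where "v2 = weak_deriv unit_square (0, 1) u"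
  define f where "f = (\<lambda>p. - (weak_deriv unit_square (2, 0) u p + weak_deriv unit_square (0, 2) u p))"
  define w1 where "w1 = (\<lambda>p. v1 p - (\<Sum>i\<in>modes M. coeff u i * partial (1, 0) (eigen i) p))"
  define w2 where "w2 = (\<lambda>p. v2 p - (\<Sum>i\<in>modes M. coeff u i * partial (0, 1) (eigen i) p))"
  define w where "w = (\<lambda>p. u p - spectral_proj M u p)"
  define g where "g = (\<lambda>p. f p - spectral_proj M f p)"
  define lam where "lam i = eigenval (fst i) (snd i)" for i
  have d: "has_weak_deriv unit_square (1, 0) u v1" "has_weak_deriv unit_square (0, 1) u v2"
    unfolding v1_def v2_def by (rule sobolev_has_weak_deriv[OF u(1)]; simp)+
  have green_u: "green u v1 v2"
    by (rule H10_green[OF u(2) d])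
  note L2_u = green_L2[OF green_u]
  have f_L2: "f \<in> L2 unit_square"
    unfolding f_def using has_weak_deriv_L2(2)[OF sobolev_has_weak_deriv[OF u(1)]]
    by (intro L2_minus L2_add) simp_all
  have f: "L2_inner unit_square v1 (partial (1, 0) \<psi>) + L2_inner unit_square v2 (partial (0, 1) \<psi>) =
      L2_inner unit_square f \<psi>" if "\<psi> \<in> test_functions unit_square" for \<psi>
    using weak_laplacian[OF u(1) that] by (simp add: v1_def v2_def f_def)

  \<comment> \<open>Green's formula is used twice on the same pairing of gradients: with the mode as
    the tested function it yields \<open>coeff f i\<close>, with \<open>u\<close> as the tested
    function it yields \<open>lam i * coeff u i\<close>.\<close>
  have coeff_f: "coeff f i = lam i * coeff u i" if i: "i \<in> modes N" for i N
  proof -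
    note L2_i = green_L2[OF eigen_green[OF i]]
    have "L2_inner unit_square v1 (partial (1, 0) (eigen i)) + L2_inner unit_square v2 (partial (0, 1) (eigen i)) =
        L2_inner unit_square f (eigen i)"
      using L2_u f_L2 f by (intro greenD[OF eigen_green[OF i]]) auto
    moreover have "L2_inner unit_square (partial (1, 0) (eigen i)) v1 + L2_inner unit_square (partial (0, 1) (eigen i)) v2 =
        L2_inner unit_square (\<lambda>p. lam i * eigen i p) u"
      using L2_i eigen_weak_eigenvalue[OF i]
      by (intro greenD[OF green_u]) (auto simp: L2_inner_cmult_left L2_cmult lam_def)
    ultimately show ?thesis
      by (simp add: eigen_coeff_def L2_inner_commute L2_inner_cmult_left L2_inner_cmult_right)
  qed

  have green_w: "green w w1 w2"
    unfolding w_def w1_def w2_def spectral_proj_eq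
    by (intro green_diff green_sum green_cmult green_u eigen_green)
  note L2_w = green_L2[OF green_w]
  have g_L2: "g \<in> L2 unit_square"
    unfolding g_def by (intro L2_diff f_L2 spectral_proj_L2)
  \<comment> \<open>\<open>g\<close> is the weak negative Laplacian of \<open>w\<close>: a projected
    term contributes \<open>lam i * coeff u i\<close>, which is \<open>coeff f i\<close>.\<close>
  have "L2_inner unit_square w1 (partial (1, 0) \<psi>) + L2_inner unit_square w2 (partial (0, 1) \<psi>) =
      L2_inner unit_square g \<psi>" if \<psi>: "\<psi> \<in> test_functions unit_square" for \<psi>
  proof -
    note L2_\<psi> = test_functions_L2[OF \<psi>] test_functions_L2[OF test_functions_partial[OF \<psi> plane_Basis(1)]]
      test_functions_L2[OF test_functions_partial[OF \<psi> plane_Basis(2)]]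
    have L2_i: "eigen i \<in> L2 unit_square" "partial (1, 0) (eigen i) \<in> L2 unit_square"
      "partial (0, 1) (eigen i) \<in> L2 unit_square" if "i \<in> modes M" for i
      using green_L2[OF eigen_green[OF that]] by auto
    have "L2_inner unit_square w1 (partial (1, 0) \<psi>) + L2_inner unit_square w2 (partial (0, 1) \<psi>) =
        L2_inner unit_square v1 (partial (1, 0) \<psi>) + L2_inner unit_square v2 (partial (0, 1) \<psi>) -
        (\<Sum>i\<in>modes M. coeff u i * (L2_inner unit_square (partial (1, 0) (eigen i)) (partial (1, 0) \<psi>) +
          L2_inner unit_square (partial (0, 1) (eigen i)) (partial (0, 1) \<psi>)))"
      unfolding w1_def w2_def using L2_u L2_\<psi> L2_i
      by (simp add: L2_inner_diff_left L2_inner_sum_left L2_inner_cmult_left L2_sum L2_cmult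
          distrib_left sum.distrib)
    also have "\<dots> = L2_inner unit_square f \<psi> - (\<Sum>i\<in>modes M. coeff f i * L2_inner unit_square (eigen i) \<psi>)"
      using \<psi> by (simp add: f eigen_weak_eigenvalue coeff_f lam_def mult_ac)
    also have "\<dots> = L2_inner unit_square g \<psi>"
      unfolding g_def spectral_proj_eq using L2_\<psi> L2_i f_L2
      by (simp add: L2_inner_diff_left L2_inner_sum_left L2_inner_cmult_left L2_sum L2_cmult)
    finally show ?thesis .
  qed
  \<comment> \<open>Green's formula for \<open>w\<close> tested with its own gradient.\<close>
  then have "(H10_norm unit_square w)\<^sup>2 = L2_inner unit_square g w"
    using L2_w g_L2 by (simp add: H10_norm_green[OF green_w] greenD[OF green_w])

  also have "L2_inner unit_square g w \<le> (L2_norm unit_square f)\<^sup>2 / (pi * real M)\<^sup>2"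
  \<comment> \<open>Subtracting the residual of \<open>u\<close> at cutoff \<open>N\<close> from
    \<open>w\<close> leaves the difference of two projections of \<open>u\<close>. Its pairing with
    \<open>g\<close> is a finite sum, bounded independently of \<open>N\<close>, and tends to the
    full pairing.\<close>
  proof (rule tendsto_upperbound)
    show "(\<lambda>N. L2_inner unit_square g w - L2_inner unit_square g (\<lambda>p. u p - spectral_proj N u p))
        \<longlonglongrightarrow> L2_inner unit_square g w"
      using tendsto_diff[OF tendsto_const residual_weak_limit[OF u(2) _ g_L2]] L2_u by simp
    have "L2_inner unit_square g w - L2_inner unit_square g (\<lambda>p. u p - spectral_proj N u p)
        \<le> (L2_norm unit_square f)\<^sup>2 / (pi * real M)\<^sup>2" if "M \<le> N" for N
    proof -
      have coeff_g: "coeff g i = (if i \<in> modes M then 0 else coeff f i)" if "i \<in> modes N" for i N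
        using coeff_spectral_proj[OF that, of M f] f_L2 eigen_L2[OF that]
        by (simp add: g_def eigen_coeff_def L2_inner_diff_left spectral_proj_L2)
      have "L2_inner unit_square g w - L2_inner unit_square g (\<lambda>p. u p - spectral_proj N u p) =
          (\<Sum>i\<in>modes N. coeff u i * coeff g i) - (\<Sum>i\<in>modes M. coeff u i * coeff g i)"
        unfolding w_def using L2_u g_L2
        by (simp add: L2_inner_diff_right spectral_proj_L2 inner_spectral_proj)
      \<comment> \<open>\<open>g\<close> has zero coefficients inside \<open>modes M\<close>, so the
        second sum vanishes.\<close>
      also have "\<dots> = (\<Sum>i\<in>modes N. coeff u i * coeff g i)"
        by (simp add: coeff_g)
      also have "\<dots> \<le> (\<Sum>i\<in>modes N. (coeff f i)\<^sup>2 / (pi * real M)\<^sup>2)"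
      proof (rule sum_mono)
        fix i assume i: "i \<in> modes N"
        show "coeff u i * coeff g i \<le> (coeff f i)\<^sup>2 / (pi * real M)\<^sup>2"
        proof (cases "i \<in> modes M")
          case True
          then show ?thesis by (simp add: coeff_g)
        next
          case False
          have "(real M)\<^sup>2 \<le> (real (fst i))\<^sup>2 \<or> (real M)\<^sup>2 \<le> (real (snd i))\<^sup>2"
            using False i by (auto simp: modes_def mem_Times_iff intro!: power_mono)
          then have "(real M)\<^sup>2 \<le> (real (fst i))\<^sup>2 + (real (snd i))\<^sup>2"
            by (auto intro: add_increasing add_increasing2)
          then have lam: "(pi * real M)\<^sup>2 \<le> lam i"
            by (simp add: lam_def eigenval_def power_mult_distrib)
          have pos: "0 < (pi * real M)\<^sup>2" using M by simp
          have "coeff u i * coeff g i = (coeff f i)\<^sup>2 / lam i"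
            using False lam pos coeff_f[OF i] coeff_g[OF i]
            by (simp add: power2_eq_square)
          also have "\<dots> \<le> (coeff f i)\<^sup>2 / (pi * real M)\<^sup>2"
            using lam pos order_less_le_trans[OF pos lam] by (intro divide_left_mono mult_pos_pos) auto
          finally show ?thesis .
        qed
      qed
      also have "\<dots> = (\<Sum>i\<in>modes N. (coeff f i)\<^sup>2) / (pi * real M)\<^sup>2"
        by (simp add: sum_divide_distrib)
      also have "\<dots> \<le> (L2_norm unit_square f)\<^sup>2 / (pi * real M)\<^sup>2"
        by (intro divide_right_mono Bessel f_L2) simp
      finally show ?thesis .
    qed
    then show "\<forall>\<^sub>F N in sequentially. L2_inner unit_square g w -
        L2_inner unit_square g (\<lambda>p. u p - spectral_proj N u p) \<le> (L2_norm unit_square f)\<^sup>2 / (pi * real M)\<^sup>2"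
      by (rule eventually_sequentiallyI)
  qed simp
  also have "\<dots> \<le> 2 * (sobolev_norm 2 unit_square u)\<^sup>2 / (pi * real M)\<^sup>2"
    unfolding f_def by (intro divide_right_mono laplacian_norm_le u) simp
  finally show ?thesis by (simp add: w_def)
qed

text \<open>The range starts at 2 because \<open>ln 1 = 0\<close>: for \<open>M = 1\<close> the
  right side is 0, while a mode such as \<open>sin_mode 2 1\<close> is annihilated by the projector
  and has nonzero energy.\<close>

theorem theorem4p1:
  shows "\<exists>C>0. \<forall>u \<in> sobolev 2 unit_square \<inter> H10 unit_square. \<forall>M::nat. M \<ge> 2 \<longrightarrow>
    H10_norm unit_square (\<lambda>p. u p - spectral_proj M u p)
      \<le> C * (sqrt (ln (real M)) / real M) * sobolev_norm 2 unit_square u"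
proof (intro exI[of _ 1] conjI ballI allI impI)
  fix u and M :: nat
  assume u: "u \<in> sobolev 2 unit_square \<inter> H10 unit_square" and M: "2 \<le> M"
  let ?U = "sobolev_norm 2 unit_square u"
  \<comment> \<open>The chain uses \<open>pi > 3\<close> and
    \<open>2 / 9 \<le> 2 / 3 \<le> ln 2\<close>; it absorbs the constant of the energy bound into
    the logarithm.\<close>
  have "2 / pi\<^sup>2 \<le> 2 / 3\<^sup>2"
    using pi_gt3 by (intro divide_left_mono power_mono) auto
  also have "\<dots> \<le> ln 2"
    using ln2_ge_two_thirds by simp
  also have "\<dots> \<le> ln (real M)"
    using M by simp
  finally have log: "2 / pi\<^sup>2 \<le> ln (real M)" .
  show "H10_norm unit_square (\<lambda>p. u p - spectral_proj M u p) \<le> 1 * (sqrt (ln (real M)) / real M) * ?U"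
  proof (rule power2_le_imp_le)
    have "(H10_norm unit_square (\<lambda>p. u p - spectral_proj M u p))\<^sup>2 \<le> 2 * ?U\<^sup>2 / (pi * real M)\<^sup>2"
      using projection_error_energy u M by auto
    also have "\<dots> = 2 / pi\<^sup>2 * (?U\<^sup>2 / (real M)\<^sup>2)"
      by (simp add: power_mult_distrib)
    also have "\<dots> \<le> ln (real M) * (?U\<^sup>2 / (real M)\<^sup>2)"
      using log by (intro mult_right_mono) auto
    also have "\<dots> = (1 * (sqrt (ln (real M)) / real M) * ?U)\<^sup>2"
      using M by (simp add: power_mult_distrib power_divide)
    finally show "(H10_norm unit_square (\<lambda>p. u p - spectral_proj M u p))\<^sup>2 \<le>
        (1 * (sqrt (ln (real M)) / real M) * ?U)\<^sup>2" .
    show "0 \<le> 1 * (sqrt (ln (real M)) / real M) * ?U"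
      using M by (simp add: sobolev_norm_nonneg)
  qed
qed simp

end
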